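(* Let $n\ge 2$ and let $\psi:\Sigma\to\mathbb{R}^{n+1}$ be a smooth hypersurface that is spacelike when regarded in the Lorentz-Minkowski space $\mathbb{L}^{n+1}$ and is simultaneously minimal in $\mathbb{R}^{n+1}$ and maximal in $\mathbb{L}^{n+1}$, i.e. $H_R=H_L=0$ everywhere on $\Sigma$. Then every level hypersurface of $\Sigma$ is a minimal hypersurface of the Euclidean space $\mathbb{R}^n$, i.e. its mean curvature in $\mathbb{R}^n$ vanishes identically.
   Context: $\mathbb{L}^{n+1}$ is $\mathbb{R}^{n+1}$ with coordinates $(x_1,\dots,x_{n+1})$ and the Lorentzian metric $dx_1^2+\dots+dx_n^2-dx_{n+1}^2$; $\mathbb{R}^{n+1}$ carries the usual Euclidean metric. The hyperplane $x_{n+1}=0$ is identified with the Euclidean space $\mathbb{R}^n$, and $\pi(x_1,\dots,x_{n+1})=(x_1,\dots,x_n)$. A hypersurface is a smooth $n$-dimensional manifold $\Sigma$ with a smooth immersion $\psi:\Sigma\to\mathbb{R}^{n+1}$. It is spacelike if the metric induced on it from $\mathbb{L}^{n+1}$ is Riemannian. $H_R$ and $H_L$ denote the mean curvature functions of a spacelike hypersurface with respect to the metrics of $\mathbb{R}^{n+1}$ and $\mathbb{L}^{n+1}$, respectively. The hypersurface is called minimal if $H_R=0$ and maximal if $H_L=0$. A spacelike hypersurface is locally the graph $x_{n+1}=u(x_1,\dots,x_n)$ of a smooth function $u$ over an open subset of $\mathbb{R}^n$, with $|Du|<1$, and for such a graph $$H_R=\frac1n\,\mathrm{div}\left(\frac{Du}{\sqrt{1+|Du|^2}}\right),\qquad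 H_L=\frac1n\,\mathrm{div}\left(\frac{Du}{\sqrt{1-|Du|^2}}\right),$$ where $D$, $\mathrm{div}$ and $|\cdot|$ are the gradient, divergence and Euclidean norm in $\mathbb{R}^n$. Level hypersurfaces: for $c\in\mathbb{R}$, a level hypersurface of $\Sigma$ at height $c$ is a relatively open subset $S_c$ of the level set $\{q\in\Sigma: x_{n+1}(\psi(q))=c\}$ that is a smooth embedded $(n-1)$-dimensional submanifold of $\Sigma$, regarded as a hypersurface of $\mathbb{R}^n$ through the immersion $\pi\circ\psi|_{S_c}$. In a local graph description this is the corresponding part of $\{x: u(x)=c\}\subset\mathbb{R}^n$. In particular, near points where $Du\neq 0$ the level set is always such a hypersurface. *)

theory Defs
  imports "HOL-Analysis.Analysis"
begin

section \<open>Smooth maps between open subsets of Euclidean spaces\<close>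

fun Ck_on :: "nat \<Rightarrow> 'e::euclidean_space set \<Rightarrow> ('e \<Rightarrow> 'v::euclidean_space) \<Rightarrow> bool" where
  "Ck_on 0 U f \<longleftrightarrow> continuous_on U f"
| "Ck_on (Suc k) U f \<longleftrightarrow>
     (\<forall>x\<in>U. f differentiable (at x)) \<and> (\<forall>v. Ck_on k U (\<lambda>x. frechet_derivative f (at x) v))"

text \<open>Only used for open \<open>U\<close>; the values of \<open>f\<close> outside \<open>U\<close> are then irrelevant.\<close>

definition smooth_on :: "'e::euclidean_space set \<Rightarrow> ('e \<Rightarrow> 'v::euclidean_space) \<Rightarrow> bool" where
  "smooth_on U f \<longleftrightarrow> (\<forall>k. Ck_on k U f)"


section \<open>Smooth manifolds and immersions\<close>

text \<open>A chart \<open>(U, \<phi>)\<close> consists of an open set \<open>U\<close> and a map \<open>\<phi>\<close> of which only the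
  restriction to \<open>U\<close> matters; its inverse is \<open>inv_into U \<phi>\<close>. Atlases are not required to be
  maximal.\<close>

type_synonym ('a, 'e) chart = "'a set \<times> ('a \<Rightarrow> 'e)"

definition is_chart :: "'a topology \<Rightarrow> ('a, 'e::euclidean_space) chart \<Rightarrow> bool" where
  "is_chart X = (\<lambda>(U, \<phi>). openin X U \<and> open (\<phi> ` U) \<and>
     homeomorphic_map (subtopology X U) (top_of_set (\<phi> ` U)) \<phi>)"

definition smooth_manifold ::
    "'a topology \<Rightarrow> ('a, 'e::euclidean_space) chart set \<Rightarrow> bool" where
  "smooth_manifold X A \<longleftrightarrow>
     Hausdorff_space X \<and> second_countable X \<and>
     (\<forall>C\<in>A. is_chart X C) \<and> (\<Union>(U, \<phi>)\<in>A. U) = topspace X \<and>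
     (\<forall>(U, \<phi>)\<in>A. \<forall>(V, \<theta>)\<in>A. smooth_on (\<phi> ` (U \<inter> V)) (\<theta> \<circ> inv_into U \<phi>))"

definition smooth_map ::
    "'a topology \<Rightarrow> ('a, 'e::euclidean_space) chart set \<Rightarrow>
     'b topology \<Rightarrow> ('b, 'f::euclidean_space) chart set \<Rightarrow> ('a \<Rightarrow> 'b) \<Rightarrow> bool" where
  "smooth_map X A Y B f \<longleftrightarrow>
     continuous_map X Y f \<and>
     (\<forall>(U, \<phi>)\<in>A. \<forall>(V, \<theta>)\<in>B.
        smooth_on (\<phi> ` {p\<in>U. f p \<in> V}) (\<theta> \<circ> f \<circ> inv_into U \<phi>))"

definition smooth_immersion ::
    "'a topology \<Rightarrow> ('a, 'e::euclidean_space) chart set \<Rightarrow>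
     'b topology \<Rightarrow> ('b, 'f::euclidean_space) chart set \<Rightarrow> ('a \<Rightarrow> 'b) \<Rightarrow> bool" where
  "smooth_immersion X A Y B f \<longleftrightarrow>
     smooth_map X A Y B f \<and>
     (\<forall>(U, \<phi>)\<in>A. \<forall>(V, \<theta>)\<in>B. \<forall>x \<in> \<phi> ` {p\<in>U. f p \<in> V}.
        inj (frechet_derivative (\<theta> \<circ> f \<circ> inv_into U \<phi>) (at x)))"

text \<open>An embedded submanifold is a subset \<open>S\<close> whose subspace topology carries a smooth structure
  (with atlas \<open>B\<close>) that makes the inclusion an immersion.\<close>

definition embedded_submanifold ::
    "'a topology \<Rightarrow> ('a, 'e::euclidean_space) chart set \<Rightarrow>
     'a set \<Rightarrow> ('a, 'f::euclidean_space) chart set \<Rightarrow> bool" where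
  "embedded_submanifold X A S B \<longleftrightarrow>
     smooth_manifold X A \<and> S \<subseteq> topspace X \<and>
     smooth_manifold (subtopology X S) B \<and>
     smooth_immersion (subtopology X S) B X A (\<lambda>q. q)"


section \<open>Hypersurfaces and mean curvature\<close>

definition hypersurface ::
    "'a topology \<Rightarrow> ('a, real^'k::finite) chart set \<Rightarrow> ('a \<Rightarrow> 'v::euclidean_space) \<Rightarrow> bool" where
  "hypersurface X A \<psi> \<longleftrightarrow>
     DIM('v) = CARD('k) + 1 \<and> smooth_manifold X A \<and>
     smooth_immersion X A euclidean {(UNIV, \<lambda>y. y)} \<psi>"

text \<open>The ambient metric is a parameter \<open>b\<close>. It is either \<^term>\<open>inner\<close> or the following metric
  on \<open>\<real>\<^sup>n\<^sup>+\<^sup>1\<close>, represented as the product of \<open>\<real>\<^sup>n\<close> with the axis of the last coordinate.\<close>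

definition lorentz :: "'e::real_inner \<times> real \<Rightarrow> 'e \<times> real \<Rightarrow> real" where
  "lorentz v w = fst v \<bullet> fst w - snd v * snd w"

definition spacelike ::
    "('a, real^'k::finite) chart set \<Rightarrow> ('a \<Rightarrow> 'e::euclidean_space \<times> real) \<Rightarrow> bool" where
  "spacelike A \<psi> \<longleftrightarrow>
     (\<forall>(U, \<phi>)\<in>A. \<forall>x \<in> \<phi> ` U. \<forall>v. v \<noteq> 0 \<longrightarrow>
        (let D = frechet_derivative (\<psi> \<circ> inv_into U \<phi>) (at x) in lorentz (D v) (D v) > 0))"

definition partial_deriv ::
    "'k::finite \<Rightarrow> (real^'k \<Rightarrow> 'v::euclidean_space) \<Rightarrow> real^'k \<Rightarrow> 'v" where
  "partial_deriv i F x = frechet_derivative F (at x) (axis i 1)"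

definition first_fundamental_form ::
    "('v \<Rightarrow> 'v \<Rightarrow> real) \<Rightarrow> (real^'k::finite \<Rightarrow> 'v::euclidean_space) \<Rightarrow> real^'k \<Rightarrow> real^'k^'k" where
  "first_fundamental_form b F x = (\<chi> i j. b (partial_deriv i F x) (partial_deriv j F x))"

definition unit_normal ::
    "('v \<Rightarrow> 'v \<Rightarrow> real) \<Rightarrow> (real^'k::finite \<Rightarrow> 'v::euclidean_space) \<Rightarrow> real^'k \<Rightarrow> 'v \<Rightarrow> bool" where
  "unit_normal b F x N \<longleftrightarrow> (\<forall>i. b (partial_deriv i F x) N = 0) \<and> \<bar>b N N\<bar> = 1"

definition second_fundamental_form ::
    "('v \<Rightarrow> 'v \<Rightarrow> real) \<Rightarrow> (real^'k::finite \<Rightarrow> 'v::euclidean_space) \<Rightarrow> real^'k \<Rightarrow> 'v \<Rightarrow> real^'k^'k" where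
  "second_fundamental_form b F x N = (\<chi> i j. b (partial_deriv i (partial_deriv j F) x) N)"

text \<open>The factor \<open>b N N\<close> is the sign of the normal direction: \<open>1\<close> in the Euclidean metric and \<open>-1\<close>
  for a spacelike hypersurface in the Lorentzian one. With it, \<open>mean_curvature b F x N *\<^sub>R N\<close> is
  the mean curvature vector. For a graph \<open>F x = (x, u x)\<close> and the unit normal
  with positive last coordinate, the value is \<open>1/n\<close> times the divergence of
  \<open>Du / sqrt (1 + |Du|^2)\<close> in the Euclidean metric, and of \<open>Du / sqrt (1 - |Du|^2)\<close> in the
  Lorentzian one.\<close>

definition mean_curvature ::
    "('v \<Rightarrow> 'v \<Rightarrow> real) \<Rightarrow> (real^'k::finite \<Rightarrow> 'v::euclidean_space) \<Rightarrow> real^'k \<Rightarrow> 'v \<Rightarrow> real" where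
  "mean_curvature b F x N =
     b N N / real CARD('k) *
     trace (matrix_inv (first_fundamental_form b F x) ** second_fundamental_form b F x N)"

text \<open>The choice of the unit normal affects only the sign of the mean curvature, so its vanishing
  is expressed without choosing an orientation.\<close>

definition zero_mean_curvature ::
    "('v \<Rightarrow> 'v \<Rightarrow> real) \<Rightarrow> ('a, real^'k::finite) chart set \<Rightarrow> ('a \<Rightarrow> 'v::euclidean_space) \<Rightarrow> bool" where
  "zero_mean_curvature b A \<psi> \<longleftrightarrow>
     (\<forall>(U, \<phi>)\<in>A. \<forall>x \<in> \<phi> ` U. \<forall>N. unit_normal b (\<psi> \<circ> inv_into U \<phi>) x N \<longrightarrow>
        mean_curvature b (\<psi> \<circ> inv_into U \<phi>) x N = 0)"

definition minimal_hypersurface ::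
    "'a topology \<Rightarrow> ('a, real^'k::finite) chart set \<Rightarrow> ('a \<Rightarrow> 'v::euclidean_space) \<Rightarrow> bool" where
  "minimal_hypersurface X A \<psi> \<longleftrightarrow> hypersurface X A \<psi> \<and> zero_mean_curvature inner A \<psi>"

definition maximal_hypersurface ::
    "'a topology \<Rightarrow> ('a, real^'k::finite) chart set \<Rightarrow> ('a \<Rightarrow> 'e::euclidean_space \<times> real) \<Rightarrow> bool" where
  "maximal_hypersurface X A \<psi> \<longleftrightarrow>
     hypersurface X A \<psi> \<and> spacelike A \<psi> \<and> zero_mean_curvature lorentz A \<psi>"

definition level_hypersurface ::
    "'a topology \<Rightarrow> ('a, real^'n::finite) chart set \<Rightarrow> ('a \<Rightarrow> (real^'n) \<times> real) \<Rightarrow> real \<Rightarrow>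
     'a set \<Rightarrow> ('a, real^'m::finite) chart set \<Rightarrow> bool" where
  "level_hypersurface X A \<psi> c S B \<longleftrightarrow>
     CARD('n) = CARD('m) + 1 \<and>
     openin (subtopology X {q \<in> topspace X. snd (\<psi> q) = c}) S \<and>
     embedded_submanifold X A S B"

end

theory Submission
  imports Defs
begin

text \<open>Near each point the hypersurface is a graph of a function \<open>u\<close> with \<open>|Du| < 1\<close>. Vanishing of the two
  mean curvatures means \<open>(1 + |Du|^2) \<Delta>u = D^2u(Du, Du)\<close> and
  \<open>(1 - |Du|^2) \<Delta>u = - D^2u(Du, Du)\<close>. Adding the equations gives \<open>\<Delta>u = 0\<close>, and
  then \<open>D^2u(Du, Du) = 0\<close>. Where \<open>Du \<noteq> 0\<close>, the mean curvature of the level set is, up to a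
  nonzero factor, the trace of \<open>D^2u\<close> over the orthogonal complement of \<open>Du\<close>, that is
  \<open>\<Delta>u - D^2u(Du, Du) / |Du|^2\<close>, so it vanishes (\<open>level_curvature_at_regular_point\<close>).

  A level hypersurface \<open>S\<close> may a priori contain points where \<open>Du = 0\<close>, about which this computation
  says nothing. But the regular points are dense in \<open>S\<close>. Near a point of \<open>S\<close> the level set is just \<open>S\<close>,
  whose dimension is too small for it to have interior points; so there are points off the level set
  arbitrarily close by, and the largest ball around such a point on which \<open>u\<close> avoids the level touches
  \<open>S\<close> nearby. As \<open>u\<close> is harmonic, the Hopf boundary point lemma gives \<open>Du \<noteq> 0\<close> at the point of
  contact (\<open>regular_point_on_level_set\<close>). Since the mean curvature of \<open>S\<close> is continuous, it vanishes on
  all of \<open>S\<close> (\<open>mean_curvature_zero_closed\<close>).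

  No graph parametrisation is constructed. In a chart the immersion is a pair \<open>(P, w)\<close> of a
  horizontal part \<open>P\<close> and a height \<open>w\<close>; spacelikeness makes the derivative of \<open>P\<close> invertible, so \<open>P\<close>
  is locally a change of coordinates with \<open>w = u \<circ> P\<close>. The quantities \<open>Du\<close> and \<open>D^2u\<close> are
  written in terms of derivatives of \<open>P\<close> and \<open>w\<close> (\<open>graph_gradient\<close>, \<open>graph_hessian\<close>), and \<open>\<Delta>u = 0\<close>
  becomes a linear elliptic equation \<open>\<Sum>\<^sub>k w''(e\<^sub>k, e\<^sub>k) + w'(\<beta>) = 0\<close> for \<open>w\<close>, where the vectors \<open>e\<^sub>k\<close> are the
  columns of the inverse Jacobian matrix of \<open>P\<close>. The Hopf lemma is proved for operators of this form.\<close>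

section \<open>C^k maps on open sets\<close>

abbreviation second_deriv where
  "second_deriv f x v w \<equiv> frechet_derivative (\<lambda>y. frechet_derivative f (at y) v) (at x) w"

lemma Ck_on_subset: "Ck_on k U f \<Longrightarrow> W \<subseteq> U \<Longrightarrow> Ck_on k W f"
  by (induction k arbitrary: f) (auto intro: continuous_on_subset)

lemma Ck_on_local:
  assumes "\<And>x. x \<in> U \<Longrightarrow> \<exists>W. open W \<and> x \<in> W \<and> Ck_on k W f"
  shows "Ck_on k U f"
  using assms
proof (induction k arbitrary: f)
  case 0
  have "continuous (at x within U) f" if x: "x \<in> U" for x
  proof -
    obtain W where "open W" "x \<in> W" "continuous_on W f"
      using 0[OF x] by auto
    then show ?thesis
      using continuous_at_imp_continuous_at_within continuous_on_eq_continuous_at by blast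
  qed
  then show ?case by (simp add: continuous_on_eq_continuous_within)
next
  case (Suc k)
  have "f differentiable at x" if "x \<in> U" for x
    using Suc.prems[OF that] by auto
  moreover have "Ck_on k U (\<lambda>x. frechet_derivative f (at x) v)" for v
    by (rule Suc.IH) (use Suc.prems in fastforce)
  ultimately show ?case by simp
qed

lemma Ck_on_cong:
  assumes "open U" "\<And>x. x \<in> U \<Longrightarrow> f x = g x" "Ck_on k U f"
  shows "Ck_on k U g"
  using assms(2,3)
proof (induction k arbitrary: f g)
  case 0
  then show ?case using continuous_on_cong[of U U f g] by simp
next
  case (Suc k)
  have eq: "frechet_derivative f (at x) = frechet_derivative g (at x)" if "x \<in> U" for x
    using that Suc.prems assms(1) by (intro frechet_derivative_transform_within_open) auto
  have "g differentiable at x" if "x \<in> U" for x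
  proof -
    have "(f has_derivative frechet_derivative f (at x)) (at x)"
      using that Suc.prems by (simp add: frechet_derivative_works)
    then show ?thesis
      using has_derivative_transform_within_open[OF _ assms(1) that, of f _ UNIV g] Suc.prems(1)
      unfolding differentiable_def by blast
  qed
  moreover have "Ck_on k U (\<lambda>x. frechet_derivative g (at x) v)" for v
    by (rule Suc.IH[of "\<lambda>x. frechet_derivative f (at x) v"]) (use Suc.prems eq in auto)
  ultimately show ?case by simp
qed

lemma Ck_on_imp_continuous_on: "Ck_on k U f \<Longrightarrow> continuous_on U f"
  by (cases k) (auto intro!: continuous_at_imp_continuous_on differentiable_imp_continuous_within)

lemma Ck_on_SucD: "Ck_on (Suc k) U f \<Longrightarrow> Ck_on k U f"
proof (induction k arbitrary: f)
  case 0
  then show ?case using Ck_on_imp_continuous_on[OF 0] by simp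
next
  case (Suc k)
  have "Ck_on k U (\<lambda>x. frechet_derivative f (at x) v)" for v
    by (rule Suc.IH) (use Suc.prems Ck_on.simps(2)[of "Suc k" U f] in blast)
  then show ?case using Suc.prems Ck_on.simps(2) by blast
qed

lemma Ck_on_const: "Ck_on k U (\<lambda>x. c)"
  by (induction k arbitrary: c) simp_all

lemma Ck_on_add:
  assumes "open U" "Ck_on k U f" "Ck_on k U g"
  shows "Ck_on k U (\<lambda>x. f x + g x)"
  using assms(2,3)
proof (induction k arbitrary: f g)
  case (Suc k)
  have "Ck_on k U (\<lambda>x. frechet_derivative (\<lambda>x. f x + g x) (at x) v)" for v
  proof (rule Ck_on_cong[OF assms(1)])
    show "Ck_on k U (\<lambda>x. frechet_derivative f (at x) v + frechet_derivative g (at x) v)"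
      by (rule Suc.IH) (use Suc.prems in auto)
    fix x assume "x \<in> U"
    then have "((\<lambda>x. f x + g x) has_derivative
        (\<lambda>v. frechet_derivative f (at x) v + frechet_derivative g (at x) v)) (at x)"
      using Suc.prems by (intro has_derivative_add) (auto simp: frechet_derivative_works[symmetric])
    then show "frechet_derivative f (at x) v + frechet_derivative g (at x) v =
        frechet_derivative (\<lambda>x. f x + g x) (at x) v"
      by (simp add: frechet_derivative_at[symmetric])
  qed
  then show ?case using Suc.prems by simp
qed (auto intro: continuous_on_add)

lemma Ck_on_sum:
  assumes "open U" "\<And>i. i \<in> I \<Longrightarrow> Ck_on k U (f i)"
  shows "Ck_on k U (\<lambda>x. \<Sum>i\<in>I. f i x)"
  using assms(2) by (induction I rule: infinite_finite_induct)
    (auto intro: Ck_on_const Ck_on_add[OF assms(1)])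

lemma Ck_on_bounded_bilinear:
  assumes "bounded_bilinear mul" "open U" "Ck_on k U f" "Ck_on k U g"
  shows "Ck_on k U (\<lambda>x. mul (f x) (g x))"
  using assms(3,4)
proof (induction k arbitrary: f g)
  case 0
  then show ?case using bounded_bilinear.continuous_on[OF assms(1)] by simp
next
  case (Suc k)
  let ?d = "\<lambda>x v. mul (f x) (frechet_derivative g (at x) v) + mul (frechet_derivative f (at x) v) (g x)"
  have der: "((\<lambda>x. mul (f x) (g x)) has_derivative ?d x) (at x)" if "x \<in> U" for x
    using Suc.prems that
    by (intro bounded_bilinear.FDERIV[OF assms(1)]) (auto simp: frechet_derivative_works[symmetric])
  have "Ck_on k U (\<lambda>x. frechet_derivative (\<lambda>x. mul (f x) (g x)) (at x) v)" for v
  proof (rule Ck_on_cong[OF assms(2)])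
    show "Ck_on k U (\<lambda>x. ?d x v)"
      using Suc.prems Ck_on_SucD[of k U f] Ck_on_SucD[of k U g]
      by (intro Ck_on_add[OF assms(2)] Suc.IH) auto
  qed (simp add: frechet_derivative_at[OF der, symmetric])
  then show ?case using der by (auto simp: differentiable_def)
qed

lemma Ck_on_bounded_linear:
  assumes L: "bounded_linear L" and U: "open U" and f: "Ck_on k U f"
  shows "Ck_on k U (\<lambda>x. L (f x))"
  using f
proof (induction k arbitrary: f)
  case 0
  then show ?case using bounded_linear.continuous_on[OF L] by simp
next
  case (Suc k)
  have der: "((\<lambda>x. L (f x)) has_derivative (\<lambda>v. L (frechet_derivative f (at x) v))) (at x)"
    if "x \<in> U" for x
    using Suc.prems that
    by (intro bounded_linear.has_derivative[OF L]) (auto simp: frechet_derivative_works[symmetric])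
  have "Ck_on k U (\<lambda>x. frechet_derivative (\<lambda>x. L (f x)) (at x) v)" for v
  proof (rule Ck_on_cong[OF U])
    show "Ck_on k U (\<lambda>x. L (frechet_derivative f (at x) v))"
      by (rule Suc.IH) (use Suc.prems in auto)
  qed (simp add: frechet_derivative_at[OF der, symmetric])
  then show ?case using der by (auto simp: differentiable_def)
qed

lemma frechet_derivative_expand:
  fixes f :: "'e::euclidean_space \<Rightarrow> 'v::real_normed_vector"
  assumes "f differentiable at x"
  shows "frechet_derivative f (at x) v =
    (\<Sum>b\<in>Basis. (v \<bullet> b) *\<^sub>R frechet_derivative f (at x) b)"
proof -
  interpret linear "frechet_derivative f (at x)"
    using assms by (rule linear_frechet_derivative)
  have "frechet_derivative f (at x) v = frechet_derivative f (at x) (\<Sum>b\<in>Basis. (v \<bullet> b) *\<^sub>R b)"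
    by (simp add: euclidean_representation)
  also have "\<dots> = (\<Sum>b\<in>Basis. (v \<bullet> b) *\<^sub>R frechet_derivative f (at x) b)"
    by (simp add: sum scale)
  finally show ?thesis .
qed

lemma frechet_derivative_chain:
  assumes "f differentiable at x" "g differentiable at (f x)"
  shows "frechet_derivative (\<lambda>x. g (f x)) (at x) v =
    frechet_derivative g (at (f x)) (frechet_derivative f (at x) v)"
  using frechet_derivative_compose[OF assms] by (simp add: o_def fun_eq_iff)

text \<open>The derivative of the composition in direction \<open>v\<close> is a finite sum of products of directional
  derivatives of the two maps, so the induction on \<open>k\<close> needs only sums and bilinear products.\<close>

lemma Ck_on_compose:
  fixes f :: "'e::euclidean_space \<Rightarrow> 'f::euclidean_space" and g :: "'f \<Rightarrow> 'v::euclidean_space"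
  assumes "open U" "\<And>x. x \<in> U \<Longrightarrow> f x \<in> W" "Ck_on k U f" "Ck_on k W g"
  shows "Ck_on k U (\<lambda>x. g (f x))"
  using assms(3,4)
proof (induction k arbitrary: g)
  case 0
  then show ?case
    using continuous_on_compose2[of W g U f] assms(2) by auto
next
  case (Suc k)
  have fU: "f differentiable at x" "g differentiable at (f x)" if "x \<in> U" for x
    using Suc.prems that assms(2) by auto
  have "Ck_on k U (\<lambda>x. frechet_derivative (\<lambda>x. g (f x)) (at x) v)" for v
  proof (rule Ck_on_cong[OF assms(1)])
    have "Ck_on k U (\<lambda>x. frechet_derivative f (at x) v)"
      using Suc.prems by simp
    moreover have "Ck_on k U (\<lambda>x. frechet_derivative g (at (f x)) b)" for b
      by (rule Suc.IH) (use Suc.prems Ck_on_SucD in auto)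
    ultimately show "Ck_on k U (\<lambda>x. \<Sum>b\<in>Basis. (frechet_derivative f (at x) v \<bullet> b) *\<^sub>R
        frechet_derivative g (at (f x)) b)"
      using assms(1)
      by (intro Ck_on_sum Ck_on_bounded_bilinear[OF bounded_bilinear_scaleR]
          Ck_on_bounded_bilinear[OF bounded_bilinear_inner] Ck_on_const)
    fix x assume "x \<in> U"
    then show "(\<Sum>b\<in>Basis. (frechet_derivative f (at x) v \<bullet> b) *\<^sub>R
        frechet_derivative g (at (f x)) b) = frechet_derivative (\<lambda>x. g (f x)) (at x) v"
      using fU frechet_derivative_chain[of f x g v]
        frechet_derivative_expand[of g "f x" "frechet_derivative f (at x) v"] by simp
  qed
  moreover have "(\<lambda>x. g (f x)) differentiable at x" if "x \<in> U" for x
    using differentiable_chain_at[OF fU[OF that]] by (simp add: o_def)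
  ultimately show ?case by simp
qed

lemma Ck_on_2D:
  assumes "Ck_on 2 U f"
  shows "x \<in> U \<Longrightarrow> f differentiable at x"
    and "x \<in> U \<Longrightarrow> (\<lambda>y. frechet_derivative f (at y) v) differentiable at x"
    and "continuous_on U (\<lambda>x. frechet_derivative f (at x) v)"
    and "continuous_on U (\<lambda>x. second_deriv f x v w)"
  using assms Ck_on_imp_continuous_on[of 1 U "\<lambda>x. frechet_derivative f (at x) v"]
  by (auto simp: numeral_2_eq_2)

text \<open>Linearity in the inner direction \<open>v\<close> is not immediate, since \<open>v\<close> enters before the second
  differentiation; it holds because the first derivative is linear at all points of a neighbourhood.\<close>

lemma second_deriv_expand_left:
  fixes f :: "'e::euclidean_space \<Rightarrow> 'v::euclidean_space"
  assumes "open U" "Ck_on 2 U f" "x \<in> U"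
  shows "second_deriv f x v w = (\<Sum>b\<in>Basis. (v \<bullet> b) *\<^sub>R second_deriv f x b w)"
proof -
  note d = Ck_on_2D[OF assms(2)]
  have "((\<lambda>y. \<Sum>b\<in>Basis. (v \<bullet> b) *\<^sub>R frechet_derivative f (at y) b) has_derivative
      (\<lambda>w. \<Sum>b\<in>Basis. (v \<bullet> b) *\<^sub>R second_deriv f x b w)) (at x)"
    using d(2)[OF assms(3)]
    by (intro has_derivative_sum has_derivative_scaleR_right)
      (auto simp: frechet_derivative_works[symmetric])
  then have "((\<lambda>y. frechet_derivative f (at y) v) has_derivative
      (\<lambda>w. \<Sum>b\<in>Basis. (v \<bullet> b) *\<^sub>R second_deriv f x b w)) (at x)"
    by (rule has_derivative_transform_within_open[OF _ assms(1,3)])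
      (simp only: frechet_derivative_expand[OF d(1), symmetric])
  then show ?thesis by (simp add: frechet_derivative_at[symmetric])
qed

lemma linear_second_deriv:
  assumes "open U" "Ck_on 2 U f" "x \<in> U"
  shows "linear (second_deriv f x v)" "linear (\<lambda>v. second_deriv f x v w)"
proof -
  show "linear (second_deriv f x v)"
    using Ck_on_2D(2)[OF assms(2,3)] by (rule linear_frechet_derivative)
  show "linear (\<lambda>v. second_deriv f x v w)"
    by (subst second_deriv_expand_left[OF assms])
      (auto intro!: linearI simp: inner_add_left scaleR_add_left sum.distrib scaleR_right.sum)
qed

lemma continuous_on_second_deriv:
  fixes f :: "'e::euclidean_space \<Rightarrow> 'v::euclidean_space"
  assumes U: "open U" and f: "Ck_on 2 U f"
    and h: "continuous_on S h" "\<And>x. x \<in> S \<Longrightarrow> h x \<in> U"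
    and "continuous_on S a" "continuous_on S b"
  shows "continuous_on S (\<lambda>x. second_deriv f (h x) (a x) (b x))"
proof -
  have "continuous_on S (\<lambda>x. \<Sum>i\<in>Basis. \<Sum>j\<in>Basis.
      (a x \<bullet> i) *\<^sub>R (b x \<bullet> j) *\<^sub>R second_deriv f (h x) i j)"
    using h(2) by (intro continuous_intros assms continuous_on_compose2[OF Ck_on_2D(4)[OF f] h(1)]) auto
  then show ?thesis
  proof (rule continuous_on_eq)
    fix x assume x: "x \<in> S"
    show "(\<Sum>i\<in>Basis. \<Sum>j\<in>Basis. (a x \<bullet> i) *\<^sub>R (b x \<bullet> j) *\<^sub>R second_deriv f (h x) i j) =
        second_deriv f (h x) (a x) (b x)"
      by (simp add: second_deriv_expand_left[OF U f h(2)[OF x], of "a x"]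
        frechet_derivative_expand[OF Ck_on_2D(2)[OF f h(2)[OF x]], of _ "b x"] scaleR_right.sum)
  qed
qed

lemma second_deriv_cong:
  assumes "open U" "Ck_on 2 U f" "x \<in> U" "\<And>y. y \<in> U \<Longrightarrow> f y = g y"
  shows "second_deriv f x v w = second_deriv g x v w"
proof -
  have "frechet_derivative f (at y) = frechet_derivative g (at y)" if "y \<in> U" for y
    using assms that by (intro frechet_derivative_transform_within_open Ck_on_2D(1)[OF assms(2)])
  then have "frechet_derivative (\<lambda>y. frechet_derivative f (at y) v) (at x) =
      frechet_derivative (\<lambda>y. frechet_derivative g (at y) v) (at x)"
    using assms by (intro frechet_derivative_transform_within_open[OF Ck_on_2D(2)[OF assms(2)]]) auto
  then show ?thesis by simp
qed

lemma second_deriv_chain: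
  fixes f :: "'e::euclidean_space \<Rightarrow> 'f::euclidean_space" and g :: "'f \<Rightarrow> 'v::euclidean_space"
  assumes "open U" "open W" "\<And>x. x \<in> U \<Longrightarrow> f x \<in> W" "Ck_on 2 U f" "Ck_on 2 W g" "x \<in> U"
  shows "second_deriv (\<lambda>x. g (f x)) x v w =
    second_deriv g (f x) (frechet_derivative f (at x) v) (frechet_derivative f (at x) w) +
    frechet_derivative g (at (f x)) (second_deriv f x v w)"
proof -
  note df = Ck_on_2D[OF assms(4)] and dg = Ck_on_2D[OF assms(5)]
  let ?h = "\<lambda>y. \<Sum>b\<in>Basis. (frechet_derivative f (at y) v \<bullet> b) *\<^sub>R frechet_derivative g (at (f y)) b"
  have fx: "f x \<in> W" using assms by auto
  have "((\<lambda>y. frechet_derivative g (at (f y)) b) has_derivative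
      (\<lambda>w. second_deriv g (f x) b (frechet_derivative f (at x) w))) (at x)" for b
    using diff_chain_at[of f "frechet_derivative f (at x)" x "\<lambda>y. frechet_derivative g (at y) b"
        "second_deriv g (f x) b"] df(1)[OF assms(6)] dg(2)[OF fx, of b]
    by (simp add: o_def frechet_derivative_works)
  moreover have "((\<lambda>y. frechet_derivative f (at y) v) has_derivative second_deriv f x v) (at x)"
    using df(2)[OF assms(6)] by (simp add: frechet_derivative_works)
  ultimately have "(?h has_derivative (\<lambda>w. \<Sum>b\<in>Basis.
      (frechet_derivative f (at x) v \<bullet> b) *\<^sub>R second_deriv g (f x) b (frechet_derivative f (at x) w) +
      (second_deriv f x v w \<bullet> b) *\<^sub>R frechet_derivative g (at (f x)) b)) (at x)"
    by (intro has_derivative_sum has_derivative_scaleR has_derivative_inner_left)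
  then have "((\<lambda>y. frechet_derivative (\<lambda>x. g (f x)) (at y) v) has_derivative (\<lambda>w. \<Sum>b\<in>Basis.
      (frechet_derivative f (at x) v \<bullet> b) *\<^sub>R second_deriv g (f x) b (frechet_derivative f (at x) w) +
      (second_deriv f x v w \<bullet> b) *\<^sub>R frechet_derivative g (at (f x)) b)) (at x)"
  proof (rule has_derivative_transform_within_open[OF _ assms(1,6)])
    fix y assume "y \<in> U"
    then show "?h y = frechet_derivative (\<lambda>x. g (f x)) (at y) v"
      using df(1)[of y] dg(1)[OF assms(3)[of y]] frechet_derivative_chain[of f y g v]
        frechet_derivative_expand[of g "f y" "frechet_derivative f (at y) v"] by simp
  qed
  then show ?thesis
    by (simp add: frechet_derivative_at[symmetric] sum.distrib
        second_deriv_expand_left[OF assms(2,5) fx, symmetric]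
        frechet_derivative_expand[OF dg(1)[OF fx], symmetric])
qed

lemma derivatives_diff_scaled:
  fixes f g :: "'e::euclidean_space \<Rightarrow> real"
  assumes U: "open U" and f: "Ck_on 2 U f" and g: "Ck_on 2 U g"
  shows "Ck_on 2 U (\<lambda>x. f x - c * g x)"
    and "x \<in> U \<Longrightarrow> frechet_derivative (\<lambda>x. f x - c * g x) (at x) v =
      frechet_derivative f (at x) v - c * frechet_derivative g (at x) v"
    and "x \<in> U \<Longrightarrow> second_deriv (\<lambda>x. f x - c * g x) x v w =
      second_deriv f x v w - c * second_deriv g x v w"
proof -
  note df = Ck_on_2D[OF f] and dg = Ck_on_2D[OF g]
  have "Ck_on 2 U (\<lambda>x. f x + (-c) * g x)"
    by (intro Ck_on_add[OF U f] Ck_on_bounded_bilinear[OF bounded_bilinear_mult U Ck_on_const g])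
  then show C2: "Ck_on 2 U (\<lambda>x. f x - c * g x)" by simp
  have e1: "frechet_derivative (\<lambda>x. f x - c * g x) (at x) v =
      frechet_derivative f (at x) v - c * frechet_derivative g (at x) v" if "x \<in> U" for x v
  proof -
    have "((\<lambda>x. f x - c * g x) has_derivative
        (\<lambda>v. frechet_derivative f (at x) v - c * frechet_derivative g (at x) v)) (at x)"
      using df(1)[OF that] dg(1)[OF that]
      by (intro has_derivative_diff has_derivative_mult_right) (simp_all add: frechet_derivative_works)
    then show ?thesis by (simp add: frechet_derivative_at[symmetric])
  qed
  then show "x \<in> U \<Longrightarrow> frechet_derivative (\<lambda>x. f x - c * g x) (at x) v =
      frechet_derivative f (at x) v - c * frechet_derivative g (at x) v" .
  assume x: "x \<in> U"
  have "((\<lambda>y. frechet_derivative f (at y) v - c * frechet_derivative g (at y) v) has_derivative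
      (\<lambda>w. second_deriv f x v w - c * second_deriv g x v w)) (at x)"
    using df(2)[OF x, of v] dg(2)[OF x, of v]
    by (intro has_derivative_diff has_derivative_mult_right) (simp_all add: frechet_derivative_works)
  then have "((\<lambda>y. frechet_derivative (\<lambda>x. f x - c * g x) (at y) v) has_derivative
      (\<lambda>w. second_deriv f x v w - c * second_deriv g x v w)) (at x)"
    by (rule has_derivative_transform_within_open[OF _ U x]) (simp add: e1)
  then show "second_deriv (\<lambda>x. f x - c * g x) x v w =
      second_deriv f x v w - c * second_deriv g x v w"
    by (simp add: frechet_derivative_at[symmetric])
qed

lemma differentiable_fst_snd:
  assumes "G differentiable at x"
  shows "(\<lambda>x. fst (G x)) differentiable at x" "(\<lambda>x. snd (G x)) differentiable at x"
  using assms unfolding differentiable_def by (blast intro: has_derivative_fst has_derivative_snd)+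

lemma frechet_derivative_fst_snd:
  fixes G :: "'e::real_normed_vector \<Rightarrow> 'a::real_normed_vector \<times> 'b::real_normed_vector"
  assumes "G differentiable at x"
  shows "frechet_derivative (\<lambda>x. fst (G x)) (at x) v = fst (frechet_derivative G (at x) v)"
    and "frechet_derivative (\<lambda>x. snd (G x)) (at x) v = snd (frechet_derivative G (at x) v)"
proof -
  have "(G has_derivative frechet_derivative G (at x)) (at x)"
    using assms by (simp add: frechet_derivative_works)
  from has_derivative_fst[OF this] has_derivative_snd[OF this]
  show "frechet_derivative (\<lambda>x. fst (G x)) (at x) v = fst (frechet_derivative G (at x) v)"
    and "frechet_derivative (\<lambda>x. snd (G x)) (at x) v = snd (frechet_derivative G (at x) v)"
    by (simp_all add: frechet_derivative_at[symmetric])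
qed

lemma second_deriv_fst_snd:
  fixes G :: "'e::euclidean_space \<Rightarrow> 'a::euclidean_space \<times> 'b::euclidean_space"
  assumes "open U" "Ck_on 2 U G" "x \<in> U"
  shows "second_deriv (\<lambda>x. fst (G x)) x v w = fst (second_deriv G x v w)"
    and "second_deriv (\<lambda>x. snd (G x)) x v w = snd (second_deriv G x v w)"
proof -
  note d = Ck_on_2D[OF assms(2)]
  have "frechet_derivative (\<lambda>y. fst (frechet_derivative G (at y) v)) (at x) =
      frechet_derivative (\<lambda>y. frechet_derivative (\<lambda>x. fst (G x)) (at y) v) (at x)"
    using d(2)[OF assms(3)] assms(1,3) d(1)
    by (intro frechet_derivative_transform_within_open differentiable_fst_snd)
      (auto simp: frechet_derivative_fst_snd)
  moreover have "frechet_derivative (\<lambda>y. snd (frechet_derivative G (at y) v)) (at x) =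
      frechet_derivative (\<lambda>y. frechet_derivative (\<lambda>x. snd (G x)) (at y) v) (at x)"
    using d(2)[OF assms(3)] assms(1,3) d(1)
    by (intro frechet_derivative_transform_within_open differentiable_fst_snd)
      (auto simp: frechet_derivative_fst_snd)
  ultimately show "second_deriv (\<lambda>x. fst (G x)) x v w = fst (second_deriv G x v w)"
    "second_deriv (\<lambda>x. snd (G x)) x v w = snd (second_deriv G x v w)"
    using frechet_derivative_fst_snd[OF d(2)[OF assms(3), of v], of w] by simp_all
qed

section \<open>Inverses, rank-one updates and traces of matrices\<close>

lemma matrix_inv_works:
  fixes A :: "real^'n^'n"
  assumes "invertible A"
  shows "A ** matrix_inv A = mat 1" "matrix_inv A ** A = mat 1"
  using assms unfolding invertible_def matrix_inv_def
  by (metis (mono_tags, lifting) someI_ex)+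

lemma matrix_inv_unique:
  fixes A B :: "real^'n^'n"
  assumes "A ** B = mat 1"
  shows "matrix_inv A = B"
proof -
  have "invertible A"
    using assms matrix_left_right_inverse[of A B] by (auto simp: invertible_def)
  then show ?thesis
    by (metis assms matrix_inv_works(2) matrix_mul_assoc matrix_mul_lid matrix_mul_rid)
qed

lemma continuous_on_det:
  fixes A :: "'x::topological_space \<Rightarrow> real^'n^'n"
  assumes "\<And>i j. continuous_on S (\<lambda>x. A x $ i $ j)"
  shows "continuous_on S (\<lambda>x. det (A x))"
  unfolding det_def by (intro continuous_intros assms)

text \<open>By Cramer's rule the entries of the inverse are quotients of determinants.\<close>

lemma continuous_on_matrix_inv:
  fixes A :: "'x::topological_space \<Rightarrow> real^'n^'n"
  assumes A: "continuous_on S A" and inv: "\<And>x. x \<in> S \<Longrightarrow> invertible (A x)"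
  shows "continuous_on S (\<lambda>x. matrix_inv (A x))"
proof -
  let ?M = "\<lambda>k j x. (\<chi> i l. if l = k then axis j 1 $ i else A x $ i $ l) :: real^'n^'n"
  have entry: "det (?M k j x) / det (A x) = matrix_inv (A x) $ k $ j" if "x \<in> S" for k j x
  proof -
    have "A x *v (matrix_inv (A x) *v axis j 1) = axis j 1"
      using matrix_inv_works(1)[OF inv[OF that]] by (simp add: matrix_vector_mul_assoc)
    then have "matrix_inv (A x) *v axis j 1 = (\<chi> k. det (?M k j x) / det (A x))"
      using cramer[of "A x"] inv[OF that] by (simp add: invertible_det_nz)
    moreover have "(matrix_inv (A x) *v axis j 1) $ k = matrix_inv (A x) $ k $ j"
      by (simp add: matrix_vector_mul_component inner_axis)
    ultimately show ?thesis by simp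
  qed
  have "continuous_on S (\<lambda>x. ?M k j x $ i $ l)" for k j i l
    by (cases "l = k") (simp_all add: continuous_on_component A)
  moreover have "continuous_on S (\<lambda>x. det (A x))"
    by (intro continuous_on_det continuous_on_component A)
  ultimately have "continuous_on S (\<lambda>x. det (?M k j x) / det (A x))" for k j
    using inv by (intro continuous_on_divide continuous_on_det)
      (auto simp: invertible_det_nz intro!: continuous_on_component A)
  then have "continuous_on S (\<lambda>x. matrix_inv (A x) $ k $ j)" for k j
    by (rule continuous_on_eq) (simp add: entry)
  then have "continuous_on S (\<lambda>x. \<chi> k j. matrix_inv (A x) $ k $ j)"
    by (intro continuous_on_vec_lambda)
  then show ?thesis by simp
qed

lemma continuous_on_matrix_mult:
  fixes A :: "'x::topological_space \<Rightarrow> real^'b^'a" and B :: "'x \<Rightarrow> real^'c^'b"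
  assumes "continuous_on S A" "continuous_on S B"
  shows "continuous_on S (\<lambda>x. A x ** B x)"
  unfolding matrix_matrix_mult_def
  by (intro continuous_on_vec_lambda continuous_on_sum continuous_on_mult continuous_on_component assms)

lemma continuous_on_matrix_vector_mult:
  fixes A :: "'x::topological_space \<Rightarrow> real^'b^'a" and v :: "'x \<Rightarrow> real^'b"
  assumes "continuous_on S A" "continuous_on S v"
  shows "continuous_on S (\<lambda>x. A x *v v x)"
  unfolding matrix_vector_mult_def
  by (intro continuous_on_vec_lambda continuous_on_sum continuous_on_mult continuous_on_component assms)

lemma continuous_on_transpose:
  fixes A :: "'x::topological_space \<Rightarrow> real^'b^'a"
  assumes "continuous_on S A"
  shows "continuous_on S (\<lambda>x. transpose (A x))"
  unfolding transpose_def
  by (intro continuous_on_vec_lambda continuous_on_component assms)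

lemma continuous_on_trace:
  fixes A :: "'x::topological_space \<Rightarrow> real^'a^'a"
  assumes "continuous_on S A"
  shows "continuous_on S (\<lambda>x. trace (A x))"
  unfolding trace_def by (intro continuous_on_sum continuous_on_component assms)

lemma matrix_scaleR_left: "(c *\<^sub>R A) ** B = c *\<^sub>R (A ** (B::real^'a^'b))"
  by (simp add: vec_eq_iff matrix_matrix_mult_def sum_distrib_left mult_ac)

lemma matrix_scaleR_right: "(A::real^'a^'b) ** (c *\<^sub>R B) = c *\<^sub>R (A ** B)"
  by (simp add: vec_eq_iff matrix_matrix_mult_def sum_distrib_left mult_ac)

lemma matrix_neg_right: "(A::real^'a^'b) ** (- B) = - (A ** B)"
  using matrix_scaleR_right[of A "-1" B] by simp

lemma matrix_add_rdistrib: "(A + B) ** C = A ** C + B ** (C::real^'a^'b)"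
  by (simp add: vec_eq_iff matrix_matrix_mult_def sum.distrib distrib_right)

lemma matrix_diff_rdistrib: "(A - B) ** C = A ** C - B ** (C::real^'a^'b)"
  by (simp add: vec_eq_iff matrix_matrix_mult_def sum_subtractf left_diff_distrib)

lemma matrix_diff_ldistrib: "(A::real^'a^'b) ** (B - C) = A ** B - A ** C"
  by (simp add: vec_eq_iff matrix_matrix_mult_def sum_subtractf right_diff_distrib)

lemma trace_scaleR: "trace (c *\<^sub>R A) = c * trace (A::real^'a^'a)"
  by (simp add: trace_def sum_distrib_left)

lemma trace_uminus: "trace (- A) = - trace (A::real^'a^'a)"
  by (simp add: trace_def sum_negf)

lemma transpose_mult_inner: "(transpose A *v x) \<bullet> y = x \<bullet> ((A::real^'m^'n) *v y)"
  by (simp add: transpose_matrix_vector dot_lmul_matrix)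

lemma entry_eq_inner: "(A::real^'m^'n) $ i $ j = axis i 1 \<bullet> (A *v axis j 1)"
  by (simp add: inner_axis' matrix_vector_mul_component inner_axis)

lemma gram_entry:
  "(transpose A ** (A::real^'m^'n)) $ i $ j = (A *v axis i 1) \<bullet> (A *v axis j 1)"
  unfolding entry_eq_inner[of "transpose A ** A"] matrix_vector_mul_assoc[symmetric]
  by (metis inner_commute transpose_mult_inner)

lemma vec_bilinear_expand:
  fixes B :: "real^'m \<Rightarrow> real^'m \<Rightarrow> real"
  assumes "\<And>u. linear (B u)" "\<And>v. linear (\<lambda>u. B u v)"
  shows "v \<bullet> ((\<chi> i j. B (axis j 1) (axis i 1)) *v u) = B u v"
proof -
  have ex: "(\<Sum>i\<in>UNIV. u $ i *\<^sub>R axis i 1) = u" for u :: "real^'m"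
    using basis_expansion[of u] by (simp add: scalar_mult_eq_scaleR)
  have "B u v = B u (\<Sum>i\<in>UNIV. v $ i *\<^sub>R axis i 1)" by (simp only: ex)
  also have "\<dots> = (\<Sum>i\<in>UNIV. v $ i * B u (axis i 1))"
    by (simp add: linear_sum[OF assms(1)] linear_scale[OF assms(1)])
  also have "\<dots> = (\<Sum>i\<in>UNIV. v $ i * B (\<Sum>j\<in>UNIV. u $ j *\<^sub>R axis j 1) (axis i 1))" by (simp only: ex)
  also have "\<dots> = (\<Sum>i\<in>UNIV. v $ i * (\<Sum>j\<in>UNIV. u $ j * B (axis j 1) (axis i 1)))"
    by (simp add: linear_sum[OF assms(2)] linear_scale[OF assms(2)])
  finally show ?thesis
    by (simp add: inner_vec_def matrix_vector_mult_def mult.commute)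
qed

definition outer_product :: "real^'n \<Rightarrow> real^'m \<Rightarrow> real^'m^'n" where
  "outer_product x y = (\<chi> i j. x $ i * y $ j)"

lemma outer_mult_vec: "outer_product x y *v v = (y \<bullet> v) *\<^sub>R x"
  by (simp add: vec_eq_iff outer_product_def matrix_vector_mult_def inner_vec_def sum_distrib_left mult_ac)

lemma trace_outer_mult: "trace (outer_product x y ** K) = y \<bullet> (K *v x)"
  by (simp add: trace_def outer_product_def matrix_matrix_mult_def matrix_vector_mult_def inner_vec_def
      sum_distrib_left sum_distrib_right mult_ac) (subst sum.swap, simp add: mult_ac)

lemma congruence_outer:
  "transpose J ** outer_product \<xi> \<xi> ** (J::real^'m^'n) =
    outer_product (transpose J *v \<xi>) (transpose J *v \<xi>)"
  by (simp add: matrix_eq matrix_vector_mul_assoc[symmetric] outer_mult_vec transpose_mult_inner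
      scaleR_vector_matrix_assoc vector_scaleR_matrix_ac matrix_vector_mult_scaleR
      del: transpose_matrix_vector)

text \<open>By the Sherman--Morrison formula, \<open>mat 1 + s \<xi> \<xi>\<^sup>T\<close> has the inverse
  \<open>mat 1 - s / (1 + s |\<xi>|^2) \<xi> \<xi>\<^sup>T\<close>. For \<open>s = 1\<close> and \<open>s = -1\<close> the matrix
  \<open>J\<^sup>T (mat 1 + s \<xi> \<xi>\<^sup>T) J\<close> is the Euclidean and the Lorentzian first fundamental form of a graph with
  gradient \<open>\<xi>\<close>, in coordinates that differ from those of the base by the Jacobian matrix \<open>J\<close>.\<close>

lemma trace_inverse_rank_one_update:
  fixes J h :: "real^'n^'n" and \<xi> :: "real^'n" and s :: real
  defines "K \<equiv> transpose (matrix_inv J) ** h ** matrix_inv J"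
  assumes J: "invertible J" and nz: "1 + s * (\<xi> \<bullet> \<xi>) \<noteq> 0"
  shows "trace (matrix_inv (transpose J ** (mat 1 + s *\<^sub>R outer_product \<xi> \<xi>) ** J) ** h) =
    trace K - s / (1 + s * (\<xi> \<bullet> \<xi>)) * (\<xi> \<bullet> (K *v \<xi>))"
proof -
  define C where "C = mat 1 - (s / (1 + s * (\<xi> \<bullet> \<xi>))) *\<^sub>R outer_product \<xi> \<xi>"
  let ?E = "matrix_inv J"
  have "(mat 1 + s *\<^sub>R outer_product \<xi> \<xi>) ** C = mat 1"
  proof (unfold matrix_eq, intro allI)
    fix v
    let ?c = "s / (1 + s * (\<xi> \<bullet> \<xi>))"
    have "(mat 1 + s *\<^sub>R outer_product \<xi> \<xi>) ** C *v v =
        v + (s * (\<xi> \<bullet> v) - ?c * (\<xi> \<bullet> v) * (1 + s * (\<xi> \<bullet> \<xi>))) *\<^sub>R \<xi>"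
      by (simp add: C_def matrix_vector_mul_assoc[symmetric] matrix_vector_mult_add_rdistrib
          matrix_vector_mult_diff_rdistrib scaleR_matrix_vector_assoc[symmetric] outer_mult_vec
          inner_diff_right algebra_simps add_divide_distrib)
    also have "\<dots> = v" using nz by simp
    finally show "(mat 1 + s *\<^sub>R outer_product \<xi> \<xi>) ** C *v v = mat 1 *v v" by simp
  qed
  moreover have "J ** ?E = mat 1" using matrix_inv_works[OF J] by simp
  moreover have "transpose J ** transpose ?E = mat 1"
    using matrix_inv_works(2)[OF J] by (metis matrix_transpose_mul transpose_mat)
  ultimately have "(transpose J ** (mat 1 + s *\<^sub>R outer_product \<xi> \<xi>) ** J) ** (?E ** C ** transpose ?E) = mat 1"
    by (metis matrix_mul_assoc matrix_mul_rid)
  then have "matrix_inv (transpose J ** (mat 1 + s *\<^sub>R outer_product \<xi> \<xi>) ** J) = ?E ** C ** transpose ?E"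
    by (rule matrix_inv_unique)
  then have "trace (matrix_inv (transpose J ** (mat 1 + s *\<^sub>R outer_product \<xi> \<xi>) ** J) ** h) =
      trace (?E ** (C ** transpose ?E ** h))"
    by (simp add: matrix_mul_assoc)
  also have "\<dots> = trace (C ** K)"
    by (subst trace_mul_sym) (simp add: K_def matrix_mul_assoc)
  also have "\<dots> = trace K - s / (1 + s * (\<xi> \<bullet> \<xi>)) * (\<xi> \<bullet> (K *v \<xi>))"
    by (simp add: C_def matrix_diff_rdistrib trace_sub matrix_scaleR_left trace_scaleR trace_outer_mult)
  finally show ?thesis .
qed

text \<open>With \<open>K\<close> the Hessian of a function \<open>u\<close> and \<open>\<xi>\<close> its gradient, the hypotheses are
  \<open>\<Delta>u = D^2u(Du, Du) / (1 + |Du|^2)\<close> and \<open>\<Delta>u = - D^2u(Du, Du) / (1 - |Du|^2)\<close>. Clearing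
  denominators and adding gives \<open>2 \<Delta>u = 0\<close>.\<close>

lemma trace_and_normal_part_vanish:
  fixes J h :: "real^'n^'n" and \<xi> :: "real^'n"
  defines "K \<equiv> transpose (matrix_inv J) ** h ** matrix_inv J"
  assumes J: "invertible J" and lt: "\<xi> \<bullet> \<xi> < 1"
    and R: "trace (matrix_inv (transpose J ** (mat 1 + outer_product \<xi> \<xi>) ** J) ** h) = 0"
    and L: "trace (matrix_inv (transpose J ** (mat 1 - outer_product \<xi> \<xi>) ** J) ** h) = 0"
  shows "trace K = 0" "\<xi> \<bullet> (K *v \<xi>) = 0"
proof -
  let ?q = "\<xi> \<bullet> \<xi>" and ?k = "\<xi> \<bullet> (K *v \<xi>)"
  have q: "0 < 1 + ?q" "0 < 1 - ?q" using lt inner_ge_zero[of \<xi>] by linarith+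
  have "trace K - ?k / (1 + ?q) = 0"
    using trace_inverse_rank_one_update[OF J, of 1 \<xi> h] R q by (simp add: K_def)
  moreover have "trace K + ?k / (1 - ?q) = 0"
    using trace_inverse_rank_one_update[OF J, of "-1" \<xi> h] L q by (simp add: K_def)
  ultimately have a: "trace K * (1 + ?q) = ?k" "trace K * (1 - ?q) = - ?k"
    using q by (auto simp: field_simps)
  then have "trace K * 2 = 0" by (simp add: algebra_simps)
  then show "trace K = 0" by simp
  with a show "?k = 0" by simp
qed

text \<open>The vectors orthogonal to a hyperplane form a line: they are the orthogonal complement of the range
  of \<open>F\<close>, which has codimension one.\<close>

lemma kernel_transpose_line:
  fixes F :: "real^'m^'n" and \<xi> n :: "real^'n"
  assumes dim: "CARD('n) = CARD('m) + 1" and F: "inj ((*v) F)"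
    and \<xi>: "\<xi> \<noteq> 0" "transpose F *v \<xi> = 0" and n: "transpose F *v n = 0"
  obtains t where "n = t *\<^sub>R \<xi>"
proof -
  let ?R = "range ((*v) F)"
  let ?V = "{y \<in> UNIV. \<forall>x \<in> ?R. orthogonal x y}"
  have R: "subspace ?R" by (simp add: linear_subspace_image)
  have "dim ?R = CARD('m)"
    using dim_image_eq[of "(*v) F" UNIV] F by (simp add: matrix_vector_mul_linear)
  moreover have "dim ?V + dim ?R = dim (UNIV :: (real^'n) set)"
    by (rule dim_subspace_orthogonal_to_vectors) (use R in auto)
  ultimately have V: "dim ?V = 1" using dim by simp
  have mem: "y \<in> ?V" if "transpose F *v y = 0" for y
    using that by (auto simp: orthogonal_def dot_lmul_matrix[symmetric] inner_commute
        transpose_matrix_vector)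
  have "?V \<subseteq> span {\<xi>}"
    using mem[OF \<xi>(2)] \<xi>(1) V by (intro card_ge_dim_independent) auto
  then have "n \<in> span {\<xi>}" using mem[OF n] by blast
  then show ?thesis using that by (auto simp: span_singleton)
qed

lemma invertible_gram:
  fixes F :: "real^'m^'n"
  assumes "inj ((*v) F)"
  shows "invertible (transpose F ** F)"
proof -
  have "x = 0" if "transpose F ** F *v x = 0" for x
  proof -
    have "(F *v x) \<bullet> (F *v x) = (transpose F ** F *v x) \<bullet> x"
      by (simp add: matrix_vector_mul_assoc[symmetric] transpose_matrix_vector dot_lmul_matrix)
    then have "F *v x = F *v 0" using that by simp
    then show ?thesis using assms by (metis injD)
  qed
  then show ?thesis
    by (simp add: invertible_left_inverse matrix_left_invertible_ker)
qed

text \<open>The left-hand side is the orthogonal projection onto the range of \<open>F\<close>, and the normal space is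
  spanned by \<open>\<xi>\<close>.\<close>

lemma projection_along_normal:
  fixes F :: "real^'m^'n" and \<xi> :: "real^'n"
  assumes dim: "CARD('n) = CARD('m) + 1" and F: "inj ((*v) F)"
    and \<xi>: "\<xi> \<noteq> 0" "transpose F *v \<xi> = 0"
  shows "F ** matrix_inv (transpose F ** F) ** transpose F = mat 1 - (1 / (\<xi> \<bullet> \<xi>)) *\<^sub>R outer_product \<xi> \<xi>"
proof (unfold matrix_eq, intro allI)
  fix z
  let ?G = "transpose F ** F"
  define p where "p = F ** matrix_inv ?G ** transpose F *v z"
  have "transpose F *v p = (?G ** matrix_inv ?G) *v (transpose F *v z)"
    by (simp add: p_def matrix_vector_mul_assoc matrix_mul_assoc del: transpose_matrix_vector)
  then have "transpose F *v (z - p) = 0"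
    using matrix_inv_works(1)[OF invertible_gram[OF F]] by (simp add: matrix_vector_mult_diff_distrib)
  then obtain t where t: "z - p = t *\<^sub>R \<xi>"
    using kernel_transpose_line[OF dim F \<xi>] by metis
  have "\<xi> \<bullet> p = (transpose F *v \<xi>) \<bullet> (matrix_inv ?G *v (transpose F *v z))"
    by (simp add: p_def matrix_vector_mul_assoc[symmetric] transpose_matrix_vector dot_lmul_matrix)
  then have "\<xi> \<bullet> p = 0" using \<xi>(2) by simp
  then have "t = (\<xi> \<bullet> z) / (\<xi> \<bullet> \<xi>)"
    using arg_cong[OF t, of "inner \<xi>"] \<xi>(1) by (simp add: inner_diff_right field_simps)
  then have "p = z - ((\<xi> \<bullet> z) / (\<xi> \<bullet> \<xi>)) *\<^sub>R \<xi>"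
    using t by (simp add: algebra_simps)
  then show "F ** matrix_inv ?G ** transpose F *v z =
      (mat 1 - (1 / (\<xi> \<bullet> \<xi>)) *\<^sub>R outer_product \<xi> \<xi>) *v z"
    by (simp add: p_def matrix_vector_mult_diff_rdistrib scaleR_matrix_vector_assoc[symmetric]
        outer_mult_vec)
qed

text \<open>The trace of the quadratic form \<open>K\<close> over the hyperplane spanned by the columns of \<open>F\<close>, computed from
  its Gram matrix, is the full trace minus the contribution of the unit normal direction.\<close>

lemma trace_on_hyperplane:
  fixes F :: "real^'m^'n" and K :: "real^'n^'n" and \<xi> :: "real^'n"
  assumes dim: "CARD('n) = CARD('m) + 1" and F: "inj ((*v) F)"
    and \<xi>: "\<xi> \<noteq> 0" "transpose F *v \<xi> = 0"
  shows "trace (matrix_inv (transpose F ** F) ** (transpose F ** K ** F)) =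
    trace K - (\<xi> \<bullet> (K *v \<xi>)) / (\<xi> \<bullet> \<xi>)"
proof -
  have "trace (matrix_inv (transpose F ** F) ** (transpose F ** K ** F)) =
      trace ((matrix_inv (transpose F ** F) ** transpose F ** K) ** F)"
    by (simp add: matrix_mul_assoc)
  also have "\<dots> = trace (F ** matrix_inv (transpose F ** F) ** transpose F ** K)"
    by (subst trace_mul_sym) (simp add: matrix_mul_assoc)
  also have "\<dots> = trace K - (\<xi> \<bullet> (K *v \<xi>)) / (\<xi> \<bullet> \<xi>)"
    by (simp add: projection_along_normal[OF assms] matrix_diff_rdistrib trace_sub
        matrix_scaleR_left trace_scaleR trace_outer_mult)
  finally show ?thesis .
qed

section \<open>The Hopf boundary point lemma and regular points of level sets\<close>

lemma has_real_derivative_along_line: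
  fixes f :: "'e::real_normed_vector \<Rightarrow> real"
  assumes "f differentiable at (x + t *\<^sub>R v)"
  shows "((\<lambda>t. f (x + t *\<^sub>R v)) has_real_derivative
    frechet_derivative f (at (x + t *\<^sub>R v)) v) (at t)"
proof -
  let ?D = "frechet_derivative f (at (x + t *\<^sub>R v))"
  have "((\<lambda>t. x + t *\<^sub>R v) has_derivative (\<lambda>h. h *\<^sub>R v)) (at t)"
    by (auto intro!: derivative_eq_intros)
  then have "((\<lambda>t. f (x + t *\<^sub>R v)) has_derivative (\<lambda>h. ?D (h *\<^sub>R v))) (at t)"
    using diff_chain_at[of "\<lambda>t. x + t *\<^sub>R v" _ t f ?D] assms
    by (simp add: frechet_derivative_works o_def)
  moreover have "(\<lambda>h. ?D (h *\<^sub>R v)) = (\<lambda>h. ?D v * h)"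
    using linear_frechet_derivative[OF assms] by (simp add: linear_scale mult.commute)
  ultimately show ?thesis by (simp add: has_field_derivative_def)
qed

text \<open>If \<open>f'\<close> vanishes at \<open>x\<close> and the second derivative along \<open>v\<close> were negative, \<open>f'\<close> would be
  negative along \<open>v\<close> just after \<open>x\<close>, and by the mean value theorem \<open>f\<close> would drop below \<open>f x\<close>.\<close>

lemma second_deriv_nonneg_at_minimum:
  fixes f :: "'e::euclidean_space \<Rightarrow> real"
  assumes U: "open U" and f: "Ck_on 2 U f" and x: "x \<in> U" and min: "\<And>y. y \<in> U \<Longrightarrow> f x \<le> f y"
  shows "frechet_derivative f (at x) v = 0" "second_deriv f x v v \<ge> 0"
proof -
  note d = Ck_on_2D[OF f]
  have D0: "frechet_derivative f (at x) = (\<lambda>v. 0)"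
    using differential_zero_maxmin[OF x U] d(1)[OF x] min by (simp add: frechet_derivative_works)
  then show "frechet_derivative f (at x) v = 0" by simp
  show "second_deriv f x v v \<ge> 0"
  proof (rule ccontr)
    let ?p = "\<lambda>t. x + t *\<^sub>R v"
    let ?g = "\<lambda>t. frechet_derivative f (at (?p t)) v"
    assume "\<not> ?thesis"
    then have neg: "second_deriv f x v v < 0" by simp
    have f1: "((\<lambda>t. f (?p t)) has_real_derivative ?g t) (at t)" if "?p t \<in> U" for t
      using d(1)[OF that] by (rule has_real_derivative_along_line)
    have "(?g has_real_derivative second_deriv f x v v) (at 0)"
      using has_real_derivative_along_line[of "\<lambda>y. frechet_derivative f (at y) v" x 0 v] d(2)[OF x]
      by simp
    then obtain d1 where d1: "d1 > 0" "\<And>h. 0 < h \<Longrightarrow> h < d1 \<Longrightarrow> ?g 0 > ?g (0 + h)"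
      using DERIV_neg_dec_right[OF _ neg] by blast
    have "open (?p -` U)"
      using U by (intro continuous_open_vimage) (auto intro!: continuous_intros)
    moreover have "0 \<in> ?p -` U" using x by simp
    ultimately obtain d2 where "d2 > 0" "ball 0 d2 \<subseteq> ?p -` U"
      by (rule openE)
    then have d2: "d2 > 0" "\<And>t. \<bar>t\<bar> < d2 \<Longrightarrow> ?p t \<in> U"
      by (auto simp: subset_iff)
    define s where "s = min d1 d2 / 2"
    have s: "0 < s" "s < d1" "s < d2" using d1 d2 by (auto simp: s_def)
    have "\<exists>z>0. z < s \<and> f (?p s) - f (?p 0) = (s - 0) * ?g z"
      using s d2(2) by (intro MVT2 f1) auto
    then obtain z where z: "0 < z" "z < s" "f (?p s) - f x = s * ?g z" by auto
    have "?g z < 0" using d1(2)[of z] z s D0 by simp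
    then have "f (?p s) < f x" using z(3) s(1) mult_pos_neg[of s "?g z"] by linarith
    moreover have "f x \<le> f (?p s)" using s d2(2)[of s] min by simp
    ultimately show False by simp
  qed
qed

text \<open>The barrier function for the Hopf lemma.\<close>

definition gaussian :: "real \<Rightarrow> 'e::euclidean_space \<Rightarrow> 'e \<Rightarrow> real" where
  "gaussian \<alpha> y x = exp (- \<alpha> * ((x - y) \<bullet> (x - y)))"

lemma gaussian_derivs:
  shows "frechet_derivative (gaussian \<alpha> y) (at x) v = - 2 * \<alpha> * ((x - y) \<bullet> v) * gaussian \<alpha> y x"
    and "second_deriv (gaussian \<alpha> y) x v v =
      (4 * \<alpha>\<^sup>2 * ((x - y) \<bullet> v)\<^sup>2 - 2 * \<alpha> * (v \<bullet> v)) * gaussian \<alpha> y x"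
    and "Ck_on 2 U (gaussian \<alpha> y)"
proof -
  have d1: "(gaussian \<alpha> y has_derivative (\<lambda>v. - 2 * \<alpha> * ((x - y) \<bullet> v) * gaussian \<alpha> y x)) (at x)" for x
    unfolding gaussian_def
    by (auto intro!: derivative_eq_intros simp: inner_commute algebra_simps)
  then have e1: "frechet_derivative (gaussian \<alpha> y) (at x) =
      (\<lambda>v. - 2 * \<alpha> * ((x - y) \<bullet> v) * gaussian \<alpha> y x)" for x
    by (simp add: frechet_derivative_at[symmetric])
  have d2: "((\<lambda>x. - 2 * \<alpha> * ((x - y) \<bullet> v) * gaussian \<alpha> y x) has_derivative
      (\<lambda>w. (4 * \<alpha>\<^sup>2 * ((x - y) \<bullet> v) * ((x - y) \<bullet> w) - 2 * \<alpha> * (w \<bullet> v)) * gaussian \<alpha> y x)) (at x)" for x v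
    by (rule derivative_eq_intros d1 refl)+ (simp add: fun_eq_iff algebra_simps power2_eq_square)
  then have e2: "second_deriv (gaussian \<alpha> y) x v =
     (\<lambda>w. (4 * \<alpha>\<^sup>2 * ((x - y) \<bullet> v) * ((x - y) \<bullet> w) - 2 * \<alpha> * (w \<bullet> v)) * gaussian \<alpha> y x)" for x v
    unfolding e1 by (simp add: frechet_derivative_at[symmetric])
  show "frechet_derivative (gaussian \<alpha> y) (at x) v = - 2 * \<alpha> * ((x - y) \<bullet> v) * gaussian \<alpha> y x"
    by (simp add: e1)
  show "second_deriv (gaussian \<alpha> y) x v v =
      (4 * \<alpha>\<^sup>2 * ((x - y) \<bullet> v)\<^sup>2 - 2 * \<alpha> * (v \<bullet> v)) * gaussian \<alpha> y x"
    by (simp add: e2 power2_eq_square)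
  have "continuous_on U (gaussian \<alpha> y)"
    unfolding gaussian_def by (intro continuous_intros)
  then have "continuous_on U (\<lambda>x. second_deriv (gaussian \<alpha> y) x v w)" for v w
    by (simp only: e2) (intro continuous_intros)
  moreover have "(\<lambda>x. frechet_derivative (gaussian \<alpha> y) (at x) v) differentiable at x" for v x
    using d2 by (simp only: e1) (auto simp: differentiable_def)
  moreover have "gaussian \<alpha> y differentiable at x" for x
    using d1 by (auto simp: differentiable_def)
  ultimately show "Ck_on 2 U (gaussian \<alpha> y)"
    by (simp add: numeral_2_eq_2)
qed

text \<open>The classical barrier argument. On the annulus between the spheres of radius \<open>R/2\<close> and \<open>R\<close>, the
  Gaussian \<open>v\<close> with a large exponent satisfies \<open>Lv > 0\<close>, where \<open>L\<close> is the operator in the hypothesis \<open>Lw\<close>. For small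
  \<open>\<epsilon>\<close> the function \<open>w - \<epsilon> v\<close> satisfies \<open>L(w - \<epsilon> v) < 0\<close>, hence has no interior
  minimum, and its minimum over the boundary is attained at \<open>q\<close>. So its derivative at \<open>q\<close> towards \<open>y\<close> is not negative,
  and the derivative of \<open>w\<close> exceeds that of \<open>\<epsilon> v\<close>, which is positive.

  Ellipticity is the statement that the vectors \<open>e k x\<close> span the space, expressed by \<open>ell\<close>.\<close>

lemma hopf_boundary_point:
  fixes w :: "'e::euclidean_space \<Rightarrow> real" and e :: "'k::finite \<Rightarrow> 'e \<Rightarrow> 'e"
  assumes U: "open U" "cball y R \<subseteq> U" and w: "Ck_on 2 U w"
    and e: "\<And>k. continuous_on U (e k)" and \<beta>: "continuous_on U \<beta>"
    and ell: "\<And>x z. x \<in> U \<Longrightarrow> z \<noteq> 0 \<Longrightarrow> \<exists>k. z \<bullet> e k x \<noteq> 0"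
    and Lw: "\<And>x. x \<in> U \<Longrightarrow>
      (\<Sum>k\<in>UNIV. second_deriv w x (e k x) (e k x)) + frechet_derivative w (at x) (\<beta> x) \<le> 0"
    and pos: "\<And>x. x \<in> ball y R \<Longrightarrow> w x > c"
    and q: "dist y q = R" "w q = c" and R: "R > 0"
  shows "frechet_derivative w (at q) (y - q) > 0"
proof -
  define A where "A = cball y R - ball y (R/2)"
  have A: "compact A" "A \<subseteq> U" "A \<noteq> {}"
    using U(2) q(1) R by (auto simp: A_def compact_diff)
  define a where "a = (\<lambda>x. \<Sum>k\<in>UNIV. ((x - y) \<bullet> e k x)\<^sup>2)"
  define b where "b = (\<lambda>x. (\<Sum>k\<in>UNIV. e k x \<bullet> e k x) + (x - y) \<bullet> \<beta> x)"
  have ca: "continuous_on A a"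
    unfolding a_def by (intro continuous_intros continuous_on_subset[OF e A(2)])
  have cb: "continuous_on A b"
    unfolding b_def
    by (intro continuous_intros continuous_on_subset[OF e A(2)] continuous_on_subset[OF \<beta> A(2)])
  have apos: "a x > 0" if "x \<in> A" for x
  proof -
    have "x - y \<noteq> 0" using that R by (auto simp: A_def)
    moreover have "x \<in> U" using \<open>x \<in> A\<close> A(2) by blast
    ultimately obtain k where "(x - y) \<bullet> e k x \<noteq> 0"
      using ell by blast
    then show ?thesis unfolding a_def by (intro sum_pos2[of _ k]) auto
  qed
  obtain xm where xm: "xm \<in> A" "\<And>x. x \<in> A \<Longrightarrow> a xm \<le> a x"
    using continuous_attains_inf[OF A(1,3) ca] by blast
  obtain B where B: "\<And>x. x \<in> A \<Longrightarrow> b x \<le> B" "B > 0"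
  proof -
    obtain xb where "\<And>x. x \<in> A \<Longrightarrow> b x \<le> b xb"
      using continuous_attains_sup[OF A(1,3) cb] by blast
    then show ?thesis by (intro that[of "\<bar>b xb\<bar> + 1"]) force+
  qed
  \<comment> \<open>The operator maps the Gaussian \<open>v\<close> to \<open>2 \<alpha> (2 \<alpha> a - b) v\<close>, and \<open>\<alpha> a \<ge> B \<ge> b\<close> on the annulus.\<close>
  define \<alpha> where "\<alpha> = B / a xm"
  have \<alpha>: "\<alpha> > 0" using B(2) apos[OF xm(1)] by (simp add: \<alpha>_def)
  let ?v = "gaussian \<alpha> y"
  have gpos: "?v x > 0" for x by (simp add: gaussian_def)
  have Lv: "(\<Sum>k\<in>UNIV. second_deriv ?v x (e k x) (e k x)) + frechet_derivative ?v (at x) (\<beta> x) > 0"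
    if "x \<in> A" for x
  proof -
    have "(\<Sum>k\<in>UNIV. second_deriv ?v x (e k x) (e k x)) + frechet_derivative ?v (at x) (\<beta> x) =
        (4 * \<alpha>\<^sup>2 * a x - 2 * \<alpha> * b x) * ?v x"
      unfolding gaussian_derivs(2) unfolding gaussian_derivs(1) a_def b_def sum_distrib_right[symmetric]
        sum_subtractf sum_distrib_left[symmetric] by (simp add: algebra_simps)
    also have "4 * \<alpha>\<^sup>2 * a x - 2 * \<alpha> * b x = 2 * \<alpha> * (2 * \<alpha> * a x - b x)"
      by (simp add: algebra_simps power2_eq_square)
    moreover have "\<alpha> * a x \<ge> B"
      using mult_left_mono[OF xm(2)[OF that], of \<alpha>] apos[OF xm(1)] \<alpha> by (simp add: \<alpha>_def)
    then have "2 * \<alpha> * a x - b x > 0"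
      using B(1)[OF that] B(2) by linarith
    ultimately show ?thesis using \<alpha> gpos by simp
  qed
  \<comment> \<open>On the inner sphere \<open>w - c\<close> has a positive lower bound \<open>\<epsilon>\<close>, and there \<open>v \<le> 1\<close>.\<close>
  have "\<exists>\<epsilon>>0. \<forall>x\<in>sphere y (R/2). c + \<epsilon> \<le> w x"
  proof (cases "sphere y (R/2) = {}")
    case False
    have "sphere y (R/2) \<subseteq> U" using U(2) R by (auto intro!: subsetD[OF U(2)])
    then have "continuous_on (sphere y (R/2)) w"
      using continuous_on_subset Ck_on_imp_continuous_on[OF w] by blast
    then obtain x0 where x0: "x0 \<in> sphere y (R/2)" "\<And>x. x \<in> sphere y (R/2) \<Longrightarrow> w x0 \<le> w x"
      using continuous_attains_inf[OF compact_sphere False] by blast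
    have "w x0 > c" using x0(1) R by (intro pos) auto
    then show ?thesis using x0(2) by (intro exI[of _ "w x0 - c"]) auto
  qed (auto intro: exI[of _ 1])
  then obtain \<epsilon> where \<epsilon>: "\<epsilon> > 0" "\<And>x. x \<in> sphere y (R/2) \<Longrightarrow> c + \<epsilon> \<le> w x" by blast
  have gle: "?v x \<le> 1" for x using \<alpha> by (simp add: gaussian_def)
  have gq: "?v x = ?v q" if "dist y x = R" for x
    using that q(1) by (simp add: gaussian_def dist_norm norm_minus_commute power2_norm_eq_inner[symmetric])
  let ?f = "\<lambda>x. w x - \<epsilon> * ?v x"
  note comb = derivatives_diff_scaled[OF U(1) w gaussian_derivs(3)[of U \<alpha> y], where c = \<epsilon>]
  have fq: "?f q \<le> ?f x" if "x \<in> A" for x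
  proof -
    have "continuous_on A ?f"
      using continuous_on_subset[OF Ck_on_imp_continuous_on[OF comb(1)] A(2)] .
    then obtain m where m: "m \<in> A" "\<And>x. x \<in> A \<Longrightarrow> ?f m \<le> ?f x"
      using continuous_attains_inf[OF A(1,3)] by blast
    \<comment> \<open>An interior minimum would contradict the sign of the operator on \<open>w - \<epsilon> v\<close>.\<close>
    have "m \<in> sphere y R \<or> m \<in> sphere y (R/2)"
    proof (rule ccontr)
      let ?I = "ball y R - cball y (R/2)"
      assume "\<not> ?thesis"
      then have mI: "m \<in> ?I" using m(1) by (auto simp: A_def)
      have I: "open ?I" "?I \<subseteq> A" "?I \<subseteq> U" using A(2) by (auto simp: A_def open_Diff)
      have mU: "m \<in> U" using mI I by blast
      have "second_deriv ?f m v v \<ge> 0" "frechet_derivative ?f (at m) v = 0" for v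
        using second_deriv_nonneg_at_minimum[OF I(1) Ck_on_subset[OF comb(1) I(3)] mI] m(2) I(2)
        by blast+
      then have "0 \<le> (\<Sum>k\<in>UNIV. second_deriv ?f m (e k m) (e k m)) + frechet_derivative ?f (at m) (\<beta> m)"
        by (simp add: sum_nonneg)
      also have "\<dots> = ((\<Sum>k\<in>UNIV. second_deriv w m (e k m) (e k m)) + frechet_derivative w (at m) (\<beta> m))
          - \<epsilon> * ((\<Sum>k\<in>UNIV. second_deriv ?v m (e k m) (e k m)) + frechet_derivative ?v (at m) (\<beta> m))"
        by (simp only: comb(2)[OF mU] comb(3)[OF mU] sum_subtractf sum_distrib_left[symmetric]
            algebra_simps)
      also have "\<dots> < 0"
        using Lw[OF mU] Lv[OF m(1)] mult_pos_pos[OF \<epsilon>(1) Lv[OF m(1)]] by linarith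
      finally show False by simp
    qed
    then have "?f q \<le> ?f m"
    proof
      assume "m \<in> sphere y R"
      then have "?v m = ?v q" using gq by simp
      moreover have "w m \<ge> c"
      proof (rule continuous_ge_on_closure[of "ball y R" w m c])
        show "continuous_on (closure (ball y R)) w"
          using R U(2) continuous_on_subset[OF Ck_on_imp_continuous_on[OF w]] by simp
        show "m \<in> closure (ball y R)" using R \<open>m \<in> sphere y R\<close> by simp
        show "w x \<ge> c" if "x \<in> ball y R" for x using pos[OF that] by simp
      qed
      ultimately show ?thesis using q(2) by simp
    next
      assume "m \<in> sphere y (R/2)"
      then have "c + \<epsilon> \<le> w m" "?v m \<le> 1" "?v q > 0" using \<epsilon>(2) gle gpos by auto
      moreover have "\<epsilon> * ?v m \<le> \<epsilon> * 1" "\<epsilon> * ?v q > 0"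
        using \<epsilon>(1) calculation by (auto intro: mult_left_mono)
      ultimately show ?thesis using q(2) by linarith
    qed
    with m(2)[OF that] show ?thesis by linarith
  qed
  have qU: "q \<in> U" using U(2) q(1) by auto
  let ?p = "\<lambda>t. q + t *\<^sub>R (y - q)"
  have deriv: "((\<lambda>t. ?f (?p t)) has_real_derivative frechet_derivative ?f (at q) (y - q)) (at 0)"
    using has_real_derivative_along_line[of ?f q 0 "y - q"] Ck_on_2D(1)[OF comb(1) qU] by simp
  have "frechet_derivative ?f (at q) (y - q) \<ge> 0"
  proof (rule ccontr)
    assume "\<not> ?thesis"
    then have neg: "frechet_derivative ?f (at q) (y - q) < 0" by simp
    obtain d where d: "d > 0" "\<And>h. 0 < h \<Longrightarrow> h < d \<Longrightarrow> ?f (?p 0) > ?f (?p (0 + h))"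
      using DERIV_neg_dec_right[OF deriv neg] by blast
    define h where "h = min (d/2) (1/2)"
    have h: "0 < h" "h < d" "h \<le> 1/2" using d(1) by (auto simp: h_def)
    have "y - ?p h = (1 - h) *\<^sub>R (y - q)" by (simp add: algebra_simps)
    then have "dist y (?p h) = (1 - h) * R"
      using h q(1) by (simp add: dist_norm)
    moreover have "(1 - h) * R \<le> R" "R / 2 \<le> (1 - h) * R"
      using h R mult_right_mono[of "1/2" "1 - h" R] by (auto simp: mult_le_cancel_right1)
    ultimately have "?p h \<in> A" by (simp add: A_def)
    then show False using fq d(2)[OF h(1,2)] by force
  qed
  moreover have "frechet_derivative ?f (at q) (y - q) =
      frechet_derivative w (at q) (y - q) - \<epsilon> * (2 * \<alpha> * R\<^sup>2 * ?v q)"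
  proof -
    have "(q - y) \<bullet> (y - q) = - ((y - q) \<bullet> (y - q))"
      by (metis inner_minus_left minus_diff_eq)
    then have "(q - y) \<bullet> (y - q) = - R\<^sup>2"
      using q(1) by (simp add: dist_norm flip: power2_norm_eq_inner)
    then show ?thesis by (simp only: comb(2)[OF qU] gaussian_derivs(1))
  qed
  moreover have "\<epsilon> * (2 * \<alpha> * R\<^sup>2 * ?v q) > 0" using \<epsilon>(1) \<alpha> R gpos by simp
  ultimately show ?thesis by linarith
qed

text \<open>A ball off the level set that touches it at a point \<open>q\<close> exists because the level set has no interior.
  As \<open>w - c\<close> has constant sign in the ball, the Hopf lemma applies to \<open>w\<close> or \<open>- w\<close>.
  Applied to small neighbourhoods of \<open>p\<close>, this yields density of the regular points.\<close>

lemma regular_point_on_level_set: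
  fixes w :: "'e::euclidean_space \<Rightarrow> real" and e :: "'k::finite \<Rightarrow> 'e \<Rightarrow> 'e"
  assumes U: "open U" and w: "Ck_on 2 U w"
    and e: "\<And>k. continuous_on U (e k)" and \<beta>: "continuous_on U \<beta>"
    and ell: "\<And>x z. x \<in> U \<Longrightarrow> z \<noteq> 0 \<Longrightarrow> \<exists>k. z \<bullet> e k x \<noteq> 0"
    and Lw: "\<And>x. x \<in> U \<Longrightarrow>
      (\<Sum>k\<in>UNIV. second_deriv w x (e k x) (e k x)) + frechet_derivative w (at x) (\<beta> x) = 0"
    and p: "p \<in> U" "w p = c" and thin: "interior {x \<in> U. w x = c} = {}"
  obtains q where "q \<in> U" "w q = c" "frechet_derivative w (at q) \<noteq> (\<lambda>v. 0)"
proof -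
  \<comment> \<open>The point \<open>y\<close> is taken within \<open>r/2\<close> of \<open>p\<close>, so that the ball up to its nearest point of the
    level set stays inside \<open>cball p r\<close>.\<close>
  obtain r where r: "r > 0" "cball p r \<subseteq> U"
    using U p(1) open_contains_cball by blast
  have "\<not> ball p (r/2) \<subseteq> {x \<in> U. w x = c}"
    using thin interior_maximal[OF _ open_ball, of p "r/2"] r(1)
    by (metis all_not_in_conv centre_in_ball half_gt_zero subset_empty)
  then obtain y where y: "y \<in> ball p (r/2)" "w y \<noteq> c"
    using r by (auto simp: subset_iff)
  define Z where "Z = {x \<in> cball p r. w x = c}"
  have cw: "continuous_on (cball p r) w"
    using continuous_on_subset[OF Ck_on_imp_continuous_on[OF w] r(2)] .
  have "closed Z"
    unfolding Z_def by (rule continuous_closed_preimage_constant[OF cw]) simp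
  moreover have pZ: "p \<in> Z" using p r by (simp add: Z_def)
  ultimately obtain q where q: "q \<in> Z" "\<And>z. z \<in> Z \<Longrightarrow> dist y q \<le> dist y z"
    using distance_attains_inf[of Z y] by auto
  define R where "R = dist y q"
  have R: "R > 0" using y(2) q(1) by (auto simp: R_def Z_def)
  have Rr: "R < r/2" using q(2)[OF pZ] y(1) by (simp add: R_def dist_commute)
  have inr: "cball y R \<subseteq> cball p r"
    using Rr y(1) by (simp add: cball_subset_cball_iff dist_commute)
  have ne: "w x \<noteq> c" if "x \<in> ball y R" for x
  proof -
    have "x \<in> cball p r" using that inr ball_subset_cball[of y R] by blast
    then show ?thesis using q(2)[of x] that by (auto simp: Z_def R_def)
  qed
  have qU: "q \<in> U" "w q = c" using q(1) r(2) by (auto simp: Z_def)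
  have yb: "y \<in> ball y R" using R by simp
  have conn: "is_interval (w ` ball y R)"
    using connected_continuous_image[of "ball y R" w] continuous_on_subset[OF cw] inr
      ball_subset_cball[of y R] by (simp add: is_interval_connected_1 subset_trans)
  have side: "w x < c \<longleftrightarrow> w y < c" if x: "x \<in> ball y R" for x
  proof (rule ccontr)
    assume "\<not> ?thesis"
    then have "c \<in> w ` ball y R"
      using conn imageI[OF x, of w] imageI[OF yb, of w] ne[OF x] ne[OF yb]
      unfolding is_interval_1 by (meson less_imp_le linorder_neqE)
    then show False using ne by blast
  qed
  have sub: "cball y R \<subseteq> U" using inr r(2) by blast
  have "frechet_derivative w (at q) (y - q) \<noteq> 0"
  proof (cases "w y < c")
    case False
    have "frechet_derivative w (at q) (y - q) > 0"
    proof (rule hopf_boundary_point[OF U sub w e \<beta> ell])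
      show "w x > c" if "x \<in> ball y R" for x
        using side[OF that] ne[OF that] False by simp
    qed (use Lw qU R in \<open>auto simp: R_def\<close>)
    then show ?thesis by simp
  next
    case True
    note neg = derivatives_diff_scaled[OF U Ck_on_const[of 2 U 0] w, where c = 1]
    have "frechet_derivative (\<lambda>x. 0 - 1 * w x) (at q) (y - q) > 0"
    proof (rule hopf_boundary_point[OF U sub neg(1) e \<beta> ell])
      show "0 - 1 * w x > - c" if "x \<in> ball y R" for x
        using side[OF that] True by simp
      show "(\<Sum>k\<in>UNIV. second_deriv (\<lambda>x. 0 - 1 * w x) x (e k x) (e k x)) +
          frechet_derivative (\<lambda>x. 0 - 1 * w x) (at x) (\<beta> x) \<le> 0" if "x \<in> U" for x
        using Lw[OF that] unfolding neg(3)[OF that] neg(2)[OF that] by (simp add: sum_negf)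
    qed (use qU R in \<open>auto simp: R_def\<close>)
    then show ?thesis unfolding neg(2)[OF qU(1)] by simp
  qed
  then have "frechet_derivative w (at q) \<noteq> (\<lambda>v. 0)" by auto
  then show ?thesis using that[OF qU] by simp
qed

section \<open>Curvature equations of a spacelike hypersurface in a chart\<close>

lemma jacobian_mult:
  fixes P :: "real^'m \<Rightarrow> real^'n"
  shows "P differentiable at x \<Longrightarrow> jacobian P (at x) *v v = frechet_derivative P (at x) v"
  unfolding jacobian_def by (metis linear_frechet_derivative matrix_vector_mul(2))

text \<open>If \<open>w = u \<circ> P\<close>, then \<open>graph_gradient P w x\<close> is the gradient of \<open>u\<close> at \<open>P x\<close>; the chain rule
  \<open>w' = u' \<circ> P'\<close> is solved for \<open>u'\<close>.\<close>

definition graph_gradient :: "(real^'n \<Rightarrow> real^'n) \<Rightarrow> (real^'n \<Rightarrow> real) \<Rightarrow> real^'n \<Rightarrow> real^'n" where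
  "graph_gradient P w x = transpose (matrix_inv (jacobian P (at x))) *v
     (\<chi> i. frechet_derivative w (at x) (axis i 1))"

text \<open>The chain rule gives \<open>w''(a, b) = D^2u(P' a, P' b) + Du \<bullet> P''(a, b)\<close> for \<open>w = u \<circ> P\<close>. So this matrix
  represents \<open>D^2u\<close> in the chart coordinates, and \<open>graph_hessian\<close> represents it in those of the base.\<close>

definition chart_hessian :: "(real^'n \<Rightarrow> real^'n) \<Rightarrow> (real^'n \<Rightarrow> real) \<Rightarrow> real^'n \<Rightarrow> real^'n^'n" where
  "chart_hessian P w x = (\<chi> i j. second_deriv w x (axis j 1) (axis i 1) -
     second_deriv P x (axis j 1) (axis i 1) \<bullet> graph_gradient P w x)"

definition graph_hessian :: "(real^'n \<Rightarrow> real^'n) \<Rightarrow> (real^'n \<Rightarrow> real) \<Rightarrow> real^'n \<Rightarrow> real^'n^'n" where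
  "graph_hessian P w x =
     transpose (matrix_inv (jacobian P (at x))) ** chart_hessian P w x ** matrix_inv (jacobian P (at x))"

lemma inner_graph_gradient:
  fixes P :: "real^'n \<Rightarrow> real^'n"
  assumes "invertible (jacobian P (at x))" "w differentiable at x"
  shows "(jacobian P (at x) *v v) \<bullet> graph_gradient P w x = frechet_derivative w (at x) v"
    and "transpose (jacobian P (at x)) *v graph_gradient P w x = (\<chi> i. frechet_derivative w (at x) (axis i 1))"
proof -
  have "transpose (jacobian P (at x)) ** transpose (matrix_inv (jacobian P (at x))) = mat 1"
    using matrix_inv_works(2)[OF assms(1)] by (metis matrix_transpose_mul transpose_mat)
  then show *: "transpose (jacobian P (at x)) *v graph_gradient P w x =
      (\<chi> i. frechet_derivative w (at x) (axis i 1))"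
    by (simp add: graph_gradient_def matrix_vector_mul_assoc del: transpose_matrix_vector)
  have "(jacobian P (at x) *v v) \<bullet> graph_gradient P w x =
      (\<chi> i. frechet_derivative w (at x) (axis i 1)) \<bullet> v"
    unfolding *[symmetric] transpose_mult_inner by (rule inner_commute)
  also have "\<dots> = (\<Sum>i\<in>UNIV. v $ i * frechet_derivative w (at x) (axis i 1))"
    by (simp add: inner_vec_def mult.commute)
  also have "\<dots> = frechet_derivative w (at x) (\<Sum>i\<in>UNIV. v $ i *\<^sub>R axis i 1)"
    using linear_frechet_derivative[OF assms(2)] by (simp add: linear_sum linear_scale)
  also have "(\<Sum>i\<in>UNIV. v $ i *\<^sub>R axis i 1) = v"
    using basis_expansion[of v] by (simp add: scalar_mult_eq_scaleR)
  finally show "(jacobian P (at x) *v v) \<bullet> graph_gradient P w x = frechet_derivative w (at x) v" .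
qed

lemma chart_hessian_apply:
  assumes "open U" "Ck_on 2 U P" "Ck_on 2 U w" "x \<in> U"
  shows "v \<bullet> (chart_hessian P w x *v u) =
    second_deriv w x u v - second_deriv P x u v \<bullet> graph_gradient P w x"
proof -
  let ?B = "\<lambda>u v. second_deriv w x u v - second_deriv P x u v \<bullet> graph_gradient P w x"
  note P = linear_second_deriv[OF assms(1,2,4)] and w = linear_second_deriv[OF assms(1,3,4)]
  have "linear (?B u)" for u
    by (rule linearI) (simp_all add: linear_add[OF P(1)] linear_add[OF w(1)] linear_scale[OF P(1)]
        linear_scale[OF w(1)] algebra_simps)
  moreover have "linear (\<lambda>u. ?B u v)" for v
    by (rule linearI) (simp_all add: linear_add[OF P(2)] linear_add[OF w(2)] linear_scale[OF P(2)]
        linear_scale[OF w(2)] algebra_simps)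
  ultimately show ?thesis unfolding chart_hessian_def by (rule vec_bilinear_expand)
qed

lemma inverse_sqrt_square: "0 < a \<Longrightarrow> 1 / sqrt a * (1 / sqrt a) * a = 1 \<and> 1 / sqrt a > 0"
  by simp

text \<open>The vectors \<open>(- \<xi>, 1)\<close> and \<open>(\<xi>, 1)\<close>, with \<open>\<xi>\<close> the gradient of the graph function, are normal in the
  Euclidean and in the Lorentzian metric, and the second fundamental forms in their directions are the
  Hessian and its negative. Spacelikeness in the direction that \<open>P'\<close> maps to \<open>\<xi>\<close> reads
  \<open>|\<xi>|^4 < |\<xi>|^2\<close>, whence \<open>|\<xi>| < 1\<close> and the Lorentzian normal can be normalised.\<close>

lemma graph_equations:
  fixes G :: "real^'n \<Rightarrow> (real^'n) \<times> real"
  defines "P \<equiv> \<lambda>x. fst (G x)" and "w \<equiv> \<lambda>x. snd (G x)"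
  assumes U: "open U" and G: "Ck_on 2 U G" and x: "x \<in> U"
    and sp: "\<And>v. v \<noteq> 0 \<Longrightarrow>
      lorentz (frechet_derivative G (at x) v) (frechet_derivative G (at x) v) > 0"
    and R: "\<And>N. unit_normal inner G x N \<Longrightarrow> mean_curvature inner G x N = 0"
    and L: "\<And>N. unit_normal lorentz G x N \<Longrightarrow> mean_curvature lorentz G x N = 0"
  shows "invertible (jacobian P (at x))" (is ?inv)
    and "trace (graph_hessian P w x) = 0" (is ?tr)
    and "graph_gradient P w x \<bullet> (graph_hessian P w x *v graph_gradient P w x) = 0" (is ?nn)
proof -
  let ?J = "jacobian P (at x)" and ?\<xi> = "graph_gradient P w x" and ?h = "chart_hessian P w x"
  let ?q = "?\<xi> \<bullet> ?\<xi>"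
  have dG: "G differentiable at x" using Ck_on_2D(1)[OF G x] .
  then have dP: "P differentiable at x" and dw: "w differentiable at x"
    unfolding P_def w_def by (auto intro: differentiable_fst_snd)
  have fG: "fst (frechet_derivative G (at x) v) = ?J *v v"
    "snd (frechet_derivative G (at x) v) = frechet_derivative w (at x) v" for v
    unfolding jacobian_mult[OF dP] unfolding P_def w_def
    by (simp_all add: frechet_derivative_fst_snd[OF dG])
  have sp': "(frechet_derivative w (at x) v)\<^sup>2 < (?J *v v) \<bullet> (?J *v v)" if "v \<noteq> 0" for v
    using sp[OF that] by (simp add: lorentz_def fG power2_eq_square)
  have "v = 0" if "?J *v v = 0" for v
    using sp'[of v] that by (cases "v = 0") (auto simp: not_less[symmetric])
  then show inv: ?inv
    by (simp add: invertible_left_inverse matrix_left_invertible_ker)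
  note grad = inner_graph_gradient[where w = w, OF inv dw]
  have grad_entry: "partial_deriv i w x = (transpose ?J *v ?\<xi>) $ i" for i
    by (simp add: grad(2) partial_deriv_def del: transpose_matrix_vector)
  have lt: "?q < 1"
  proof (cases "?\<xi> = 0")
    case False
    let ?v = "matrix_inv ?J *v ?\<xi>"
    have Jv: "?J *v ?v = ?\<xi>"
      using matrix_inv_works(1)[OF inv] by (simp add: matrix_vector_mul_assoc)
    then have "?v \<noteq> 0" using False by (metis matrix_vector_mult_0_right)
    from sp'[OF this] have "?q\<^sup>2 < ?q" using grad(1)[of ?v] by (simp add: Jv)
    moreover have "?q > 0" using False by simp
    ultimately show ?thesis by (simp add: power2_eq_square)
  qed simp
  have q0: "1 + ?q > 0" using inner_ge_zero[of ?\<xi>] by linarith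
  have pd: "partial_deriv i G x = (?J *v axis i 1, partial_deriv i w x)" for i
    by (simp add: partial_deriv_def fG prod_eq_iff)
  have pd2: "partial_deriv i (partial_deriv j G) x =
      (second_deriv P x (axis j 1) (axis i 1), second_deriv w x (axis j 1) (axis i 1))" for i j
    using second_deriv_fst_snd[OF U G x] unfolding partial_deriv_def P_def w_def
    by (simp add: prod_eq_iff)
  have ip: "(?J *v axis i 1) \<bullet> ?\<xi> = partial_deriv i w x" for i
    using grad(1) by (simp add: partial_deriv_def)
  have ff: "first_fundamental_form inner G x = transpose ?J ** (mat 1 + outer_product ?\<xi> ?\<xi>) ** ?J"
    "first_fundamental_form lorentz G x = transpose ?J ** (mat 1 - outer_product ?\<xi> ?\<xi>) ** ?J"
    unfolding matrix_add_ldistrib matrix_diff_ldistrib matrix_add_rdistrib matrix_diff_rdistrib congruence_outer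
    by (simp_all add: first_fundamental_form_def vec_eq_iff pd inner_prod_def lorentz_def gram_entry
        outer_product_def grad_entry del: transpose_matrix_vector)
  have "trace (matrix_inv (first_fundamental_form inner G x) ** ?h) = 0"
  proof -
    define c where "c = 1 / sqrt (1 + ?q)"
    have c: "c > 0" "c * c * (1 + ?q) = 1" using inverse_sqrt_square[of "1 + ?q"] q0 by (simp_all add: c_def)
    let ?N = "(- (c *\<^sub>R ?\<xi>), c)"
    have NN: "?N \<bullet> ?N = 1" using c(2) by (simp add: inner_prod_def algebra_simps)
    have "unit_normal inner G x ?N"
      using NN by (simp add: unit_normal_def pd inner_prod_def ip)
    moreover have "second_fundamental_form inner G x ?N = c *\<^sub>R ?h"
      by (simp add: second_fundamental_form_def vec_eq_iff pd2 inner_prod_def chart_hessian_def algebra_simps)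
    ultimately show ?thesis
      using R[of ?N] c(1) NN by (simp add: mean_curvature_def matrix_scaleR_right trace_scaleR)
  qed
  moreover have "trace (matrix_inv (first_fundamental_form lorentz G x) ** ?h) = 0"
  proof -
    define c where "c = 1 / sqrt (1 - ?q)"
    have c: "c > 0" "c * c * (1 - ?q) = 1" using inverse_sqrt_square[of "1 - ?q"] lt by (simp_all add: c_def)
    let ?N = "(c *\<^sub>R ?\<xi>, c)"
    have NN: "lorentz ?N ?N = - 1" using c(2) by (simp add: lorentz_def algebra_simps)
    have "unit_normal lorentz G x ?N"
      using NN by (simp add: unit_normal_def pd ip) (simp add: lorentz_def ip)
    moreover have "second_fundamental_form lorentz G x ?N = (- c) *\<^sub>R ?h"
      by (simp add: second_fundamental_form_def vec_eq_iff pd2 lorentz_def chart_hessian_def algebra_simps)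
    ultimately show ?thesis
      using L[of ?N] c(1) NN by (simp add: mean_curvature_def matrix_scaleR_right matrix_neg_right
          trace_uminus trace_scaleR)
  qed
  ultimately show ?tr ?nn
    using trace_and_normal_part_vanish[OF inv lt, of ?h] unfolding ff graph_hessian_def by blast+
qed

text \<open>The Laplacian of \<open>u\<close>, expressed as a second order operator acting on \<open>w = u \<circ> P\<close>. The vectors
  \<open>e k x\<close> are mapped to the standard basis by \<open>P'\<close>; the first order term comes from the term with
  \<open>P''\<close> in the chain rule.\<close>

lemma trace_graph_hessian:
  fixes P :: "real^'n \<Rightarrow> real^'n"
  defines "e \<equiv> \<lambda>k x. matrix_inv (jacobian P (at x)) *v axis k 1"
  assumes "open U" "Ck_on 2 U P" "Ck_on 2 U w" "x \<in> U" and inv: "invertible (jacobian P (at x))"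
  shows "trace (graph_hessian P w x) =
    (\<Sum>k\<in>UNIV. second_deriv w x (e k x) (e k x)) + frechet_derivative w (at x)
      (- (matrix_inv (jacobian P (at x)) *v (\<Sum>k\<in>UNIV. second_deriv P x (e k x) (e k x))))"
proof -
  let ?E = "matrix_inv (jacobian P (at x))" and ?V = "\<Sum>k\<in>UNIV. second_deriv P x (e k x) (e k x)"
  have dw: "w differentiable at x" using Ck_on_2D(1) assms by blast
  have "axis k 1 \<bullet> (graph_hessian P w x *v axis k 1) = e k x \<bullet> (chart_hessian P w x *v e k x)" for k
    unfolding graph_hessian_def matrix_vector_mul_assoc[symmetric] e_def
    by (metis inner_commute transpose_mult_inner)
  then have "trace (graph_hessian P w x) = (\<Sum>k\<in>UNIV. e k x \<bullet> (chart_hessian P w x *v e k x))"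
    by (simp add: trace_def entry_eq_inner[of "graph_hessian P w x"])
  also have "\<dots> = (\<Sum>k\<in>UNIV. second_deriv w x (e k x) (e k x)) - ?V \<bullet> graph_gradient P w x"
    by (simp add: chart_hessian_apply[OF assms(2-5)] sum_subtractf inner_sum_left)
  finally have tr: "trace (graph_hessian P w x) =
      (\<Sum>k\<in>UNIV. second_deriv w x (e k x) (e k x)) - ?V \<bullet> graph_gradient P w x" .
  have "?V \<bullet> graph_gradient P w x = frechet_derivative w (at x) (?E *v ?V)"
    using inner_graph_gradient(1)[OF inv dw, of "?E *v ?V"] matrix_inv_works(1)[OF inv]
    by (simp add: matrix_vector_mul_assoc)
  then show ?thesis
    using linear_frechet_derivative[OF dw] tr by (simp add: linear_neg)
qed

section \<open>Mean curvature of level sets\<close>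

lemma first_fundamental_form_jacobian:
  fixes F :: "real^'m \<Rightarrow> real^'n"
  assumes "F differentiable at x"
  shows "first_fundamental_form inner F x = transpose (jacobian F (at x)) ** jacobian F (at x)"
  by (simp add: first_fundamental_form_def vec_eq_iff partial_deriv_def jacobian_mult[OF assms]
      gram_entry)

lemma normal_iff_jacobian:
  fixes F :: "real^'m \<Rightarrow> real^'n"
  assumes "F differentiable at x"
  shows "(\<forall>i. partial_deriv i F x \<bullet> N = 0) \<longleftrightarrow> transpose (jacobian F (at x)) *v N = 0"
proof -
  have "partial_deriv i F x \<bullet> N = (transpose (jacobian F (at x)) *v N) $ i" for i
    using transpose_mult_inner[of "jacobian F (at x)" N "axis i 1"]
    by (simp add: partial_deriv_def jacobian_mult[OF assms] inner_axis' inner_commute del: transpose_matrix_vector)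
  then show ?thesis by (simp add: vec_eq_iff del: transpose_matrix_vector)
qed

text \<open>The gradient \<open>\<xi>\<close> of \<open>u\<close> is normal to the level set, so every normal \<open>N\<close> is a multiple of it.
  Differentiating \<open>w \<circ> \<sigma> = c\<close> twice shows that the second fundamental form in direction \<open>\<xi>\<close> is the
  negative of the Hessian of \<open>u\<close> restricted to the tangent space. Its trace is
  \<open>\<Delta>u - D^2u(\<xi>, \<xi>) / |\<xi>|^2\<close>.\<close>

lemma level_curvature_at_regular_point:
  fixes P :: "real^'n \<Rightarrow> real^'n" and \<sigma> :: "real^'m \<Rightarrow> real^'n"
  defines "F \<equiv> \<lambda>x. P (\<sigma> x)"
  assumes dim: "CARD('n) = CARD('m) + 1"
    and U: "open U" "Ck_on 2 U P" "Ck_on 2 U w"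
    and V: "open V" "Ck_on 2 V \<sigma>" "\<And>x. x \<in> V \<Longrightarrow> \<sigma> x \<in> U" and level: "\<And>x. x \<in> V \<Longrightarrow> w (\<sigma> x) = c"
    and x: "x \<in> V" and inv: "invertible (jacobian P (at (\<sigma> x)))"
    and F: "inj (frechet_derivative F (at x))"
    and reg: "frechet_derivative w (at (\<sigma> x)) \<noteq> (\<lambda>v. 0)"
    and tr: "trace (graph_hessian P w (\<sigma> x)) = 0"
    and nn: "graph_gradient P w (\<sigma> x) \<bullet> (graph_hessian P w (\<sigma> x) *v graph_gradient P w (\<sigma> x)) = 0"
    and N: "transpose (jacobian F (at x)) *v N = 0"
  shows "trace (matrix_inv (first_fundamental_form inner F x) ** second_fundamental_form inner F x N) = 0"
proof -
  let ?y = "\<sigma> x"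
  let ?J = "jacobian P (at ?y)" and ?\<xi> = "graph_gradient P w ?y" and ?K = "graph_hessian P w ?y"
    and ?S = "jacobian \<sigma> (at x)" and ?M = "jacobian F (at x)"
  have y: "?y \<in> U" using V(3) x .
  have dP: "P differentiable at ?y" and dw: "w differentiable at ?y" and d\<sigma>: "\<sigma> differentiable at x"
    using Ck_on_2D(1) U V x y by blast+
  note grad = inner_graph_gradient[OF inv dw]
  have dF: "F differentiable at x"
    using differentiable_chain_at[OF d\<sigma> dP] by (simp add: F_def o_def)
  have M_mult: "?M *v v = ?J *v (?S *v v)" for v
    unfolding jacobian_mult[OF dF] jacobian_mult[OF d\<sigma>] jacobian_mult[OF dP] unfolding F_def
    by (rule frechet_derivative_chain[OF d\<sigma> dP])
  then have M: "?M = ?J ** ?S" by (simp add: matrix_eq matrix_vector_mul_assoc[symmetric])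
  have w_const: "frechet_derivative (\<lambda>x. w (\<sigma> x)) (at z) = (\<lambda>v. 0)" if "z \<in> V" for z
  proof -
    have "frechet_derivative (\<lambda>x. c) (at z) = frechet_derivative (\<lambda>x. w (\<sigma> x)) (at z)"
      by (rule frechet_derivative_transform_within_open[OF _ V(1) that]) (simp_all add: level)
    then show ?thesis by simp
  qed
  have tangent: "frechet_derivative w (at ?y) (?S *v v) = 0" for v
    using frechet_derivative_chain[OF d\<sigma> dw, of v] w_const[OF x] by (simp add: jacobian_mult[OF d\<sigma>])
  have \<xi>0: "?\<xi> \<noteq> 0"
  proof
    assume "?\<xi> = 0"
    then have "frechet_derivative w (at ?y) v = 0" for v using grad(1)[of v] by simp
    then show False using reg by auto
  qed
  have \<xi>M: "transpose ?M *v ?\<xi> = 0"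
  proof -
    have "(transpose ?M *v ?\<xi>) \<bullet> v = 0" for v
      using grad(1)[of "?S *v v"] tangent[of v] M_mult
      by (simp only: transpose_mult_inner) (simp add: inner_commute)
    then show ?thesis by (metis inner_eq_zero_iff)
  qed
  have injM: "inj ((*v) ?M)" using F by (simp add: jacobian_mult[OF dF] inj_def)
  obtain t where t: "N = t *\<^sub>R ?\<xi>"
    using kernel_transpose_line[OF dim injM \<xi>0 \<xi>M N] by metis
  have sf: "second_fundamental_form inner F x N = (- t) *\<^sub>R (transpose ?M ** ?K ** ?M)"
  proof (unfold vec_eq_iff, intro allI)
    fix i j
    let ?a = "?S *v axis i 1" and ?b = "?S *v axis j 1" and ?s = "second_deriv \<sigma> x (axis j 1) (axis i 1)"
    \<comment> \<open>Second derivative of the constant function \<open>w \<circ> \<sigma>\<close>.\<close>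
    have "0 = second_deriv (\<lambda>x. w (\<sigma> x)) x (axis j 1) (axis i 1)"
      using second_deriv_cong[OF V(1) Ck_on_const x, of c "\<lambda>x. w (\<sigma> x)" "axis j 1" "axis i 1"] level by simp
    also have "\<dots> = second_deriv w ?y ?b ?a + frechet_derivative w (at ?y) ?s"
      using second_deriv_chain[OF V(1) U(1) V(3) V(2) U(3) x] by (simp add: jacobian_mult[OF d\<sigma>])
    finally have w2: "frechet_derivative w (at ?y) ?s = - second_deriv w ?y ?b ?a" by simp
    have "second_deriv F x (axis j 1) (axis i 1) \<bullet> ?\<xi> =
        second_deriv P ?y ?b ?a \<bullet> ?\<xi> + (?J *v ?s) \<bullet> ?\<xi>"
      using second_deriv_chain[OF V(1) U(1) V(3) V(2) U(2) x]
      by (simp add: F_def jacobian_mult[OF d\<sigma>] jacobian_mult[OF dP] inner_add_left)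
    also have "\<dots> = - (?a \<bullet> (chart_hessian P w ?y *v ?b))"
      by (simp add: grad(1) w2 chart_hessian_apply[OF U y])
    also have "?a \<bullet> (chart_hessian P w ?y *v ?b) = (transpose ?M ** ?K ** ?M) $ i $ j"
    proof -
      have EJ: "matrix_inv ?J *v (?J *v v) = v" for v
        using matrix_inv_works(2)[OF inv] by (simp add: matrix_vector_mul_assoc)
      have "(transpose ?M ** ?K ** ?M) $ i $ j = (?M *v axis i 1) \<bullet> (?K *v (?M *v axis j 1))"
        unfolding entry_eq_inner[of "transpose ?M ** ?K ** ?M"] matrix_vector_mul_assoc[symmetric]
        by (metis inner_commute transpose_mult_inner)
      also have "\<dots> = (matrix_inv ?J *v (?M *v axis i 1)) \<bullet>
          (chart_hessian P w ?y *v (matrix_inv ?J *v (?M *v axis j 1)))"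
        unfolding graph_hessian_def matrix_vector_mul_assoc[symmetric]
        by (metis inner_commute transpose_mult_inner)
      finally show ?thesis by (simp add: M_mult EJ)
    qed
    finally show "second_fundamental_form inner F x N $ i $ j =
        ((- t) *\<^sub>R (transpose ?M ** ?K ** ?M)) $ i $ j"
      by (simp add: second_fundamental_form_def partial_deriv_def[abs_def] t)
  qed
  show ?thesis
    unfolding sf first_fundamental_form_jacobian[OF dF] matrix_scaleR_right trace_scaleR
      trace_on_hyperplane[OF dim injM \<xi>0 \<xi>M] tr nn by simp
qed

lemma continuous_on_jacobian:
  fixes F :: "real^'m \<Rightarrow> real^'n"
  assumes "Ck_on 2 U F"
  shows "continuous_on U (\<lambda>x. jacobian F (at x))"
  unfolding jacobian_def matrix_def
  by (intro continuous_on_vec_lambda continuous_on_component Ck_on_2D(3)[OF assms])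

text \<open>The mean curvature is continuous along the hypersurface once the normal vector \<open>N\<close> at \<open>p\<close> is
  extended to a continuous field of normal vectors.\<close>

lemma mean_curvature_zero_closed:
  fixes F :: "real^'m \<Rightarrow> real^'n"
  defines "H \<equiv> \<lambda>x N. trace (matrix_inv (first_fundamental_form inner F x) ** second_fundamental_form inner F x N)"
  assumes V: "open V" and F: "Ck_on 2 V F" and inj: "\<And>x. x \<in> V \<Longrightarrow> inj (frechet_derivative F (at x))"
    and p: "p \<in> V" and N: "transpose (jacobian F (at p)) *v N = 0"
    and dense: "\<And>W. open W \<Longrightarrow> p \<in> W \<Longrightarrow> W \<subseteq> V \<Longrightarrow>
      \<exists>x\<in>W. \<forall>N. transpose (jacobian F (at x)) *v N = 0 \<longrightarrow> H x N = 0"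
  shows "H p N = 0"
proof (rule ccontr)
  assume nz: "H p N \<noteq> 0"
  let ?J = "\<lambda>x. jacobian F (at x)" and ?G = "\<lambda>x. transpose (jacobian F (at x)) ** jacobian F (at x)"
  have dF: "F differentiable at x" if "x \<in> V" for x using Ck_on_2D(1)[OF F that] .
  have G: "invertible (?G x)" if "x \<in> V" for x
    using inj[OF that] by (intro invertible_gram) (simp add: inj_def jacobian_mult[OF dF[OF that]])
  \<comment> \<open>The orthogonal projection of \<open>N\<close> onto the normal space at \<open>x\<close>.\<close>
  define n where "n = (\<lambda>x. N - ?J x *v (matrix_inv (?G x) *v (transpose (?J x) *v N)))"
  have normal: "transpose (?J x) *v n x = 0" if "x \<in> V" for x
  proof -
    have "transpose (?J x) *v (?J x *v (matrix_inv (?G x) *v (transpose (?J x) *v N))) =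
        (?G x ** matrix_inv (?G x)) *v (transpose (?J x) *v N)"
      by (simp add: matrix_vector_mul_assoc matrix_mul_assoc del: transpose_matrix_vector)
    then show ?thesis
      using matrix_inv_works(1)[OF G[OF that]]
      by (simp add: n_def matrix_vector_mult_diff_distrib del: transpose_matrix_vector)
  qed
  have np: "n p = N" using N by (simp add: n_def del: transpose_matrix_vector)
  note cJ = continuous_on_jacobian[OF F]
  have cG: "continuous_on V ?G"
    by (intro continuous_on_matrix_mult continuous_on_transpose cJ)
  have cGi: "continuous_on V (\<lambda>x. matrix_inv (?G x))"
    by (rule continuous_on_matrix_inv[OF cG G])
  have cn: "continuous_on V n"
    unfolding n_def
    by (intro continuous_on_diff continuous_on_const continuous_on_matrix_vector_mult
        continuous_on_transpose cJ cGi)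
  have "continuous_on V (\<lambda>x. trace (matrix_inv (?G x) ** second_fundamental_form inner F x (n x)))"
    unfolding second_fundamental_form_def partial_deriv_def[abs_def]
    by (intro continuous_on_trace continuous_on_matrix_mult cGi continuous_on_vec_lambda
        continuous_on_inner cn Ck_on_2D(4)[OF F])
  then have cH: "continuous_on V (\<lambda>x. H x (n x))"
    by (rule continuous_on_eq) (simp add: H_def first_fundamental_form_jacobian[OF dF])
  let ?W = "V \<inter> (\<lambda>x. H x (n x)) -` (- {0})"
  have "open ?W" by (rule continuous_open_preimage[OF cH V]) auto
  moreover have "p \<in> ?W" using p nz np by simp
  ultimately obtain x where "x \<in> ?W" "\<And>N. transpose (?J x) *v N = 0 \<Longrightarrow> H x N = 0"
    using dense[of ?W] by blast
  then show False using normal[of x] by auto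
qed

text \<open>Here \<open>\<sigma>\<close> is a level hypersurface seen in a chart of the ambient hypersurface \<open>G\<close>. The assumption
  \<open>thick\<close> says that the hypersurface is relatively open in its level set; it excludes
  pieces of smaller dimension than the level set, and it makes the regular points supplied by
  \<open>regular_point_on_level_set\<close> lie on the image of \<open>\<sigma>\<close>.\<close>

lemma level_set_mean_curvature:
  fixes G :: "real^'n \<Rightarrow> (real^'n) \<times> real" and \<sigma> :: "real^'m \<Rightarrow> real^'n"
  defines "F \<equiv> \<lambda>x. fst (G (\<sigma> x))"
  assumes dim: "CARD('n) = CARD('m) + 1"
    and U: "open U" "Ck_on 2 U G"
    and sp: "\<And>y v. y \<in> U \<Longrightarrow> v \<noteq> 0 \<Longrightarrow>
      lorentz (frechet_derivative G (at y) v) (frechet_derivative G (at y) v) > 0"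
    and R: "\<And>y N. y \<in> U \<Longrightarrow> unit_normal inner G y N \<Longrightarrow> mean_curvature inner G y N = 0"
    and L: "\<And>y N. y \<in> U \<Longrightarrow> unit_normal lorentz G y N \<Longrightarrow> mean_curvature lorentz G y N = 0"
    and V: "open V" "Ck_on 2 V \<sigma>" "\<And>x. x \<in> V \<Longrightarrow> \<sigma> x \<in> U"
    and inj: "\<And>x. x \<in> V \<Longrightarrow> inj (frechet_derivative \<sigma> (at x))"
    and level: "\<And>x. x \<in> V \<Longrightarrow> snd (G (\<sigma> x)) = c"
    and thick: "\<And>W. open W \<Longrightarrow> p \<in> W \<Longrightarrow> W \<subseteq> V \<Longrightarrow>
      \<exists>Q. open Q \<and> \<sigma> p \<in> Q \<and> Q \<subseteq> U \<and> {y \<in> Q. snd (G y) = c} \<subseteq> \<sigma> ` W"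
    and p: "p \<in> V"
  shows "\<And>x. x \<in> V \<Longrightarrow> inj (frechet_derivative F (at x))"
    and "\<And>N. unit_normal inner F p N \<Longrightarrow> mean_curvature inner F p N = 0"
proof -
  let ?P = "\<lambda>y. fst (G y)" and ?w = "\<lambda>y. snd (G y)"
  have P: "Ck_on 2 U ?P" and w: "Ck_on 2 U ?w"
    using Ck_on_bounded_linear[OF bounded_linear_fst U] Ck_on_bounded_linear[OF bounded_linear_snd U] .
  have eqs: "invertible (jacobian ?P (at y))" "trace (graph_hessian ?P ?w y) = 0"
    "graph_gradient ?P ?w y \<bullet> (graph_hessian ?P ?w y *v graph_gradient ?P ?w y) = 0" if "y \<in> U" for y
    by (rule graph_equations[OF U that sp[OF that] R[OF that] L[OF that]]; assumption)+
  have F: "Ck_on 2 V F"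
    unfolding F_def by (rule Ck_on_compose[OF V(1) V(3) V(2) P])
  show injF: "inj (frechet_derivative F (at x))" if x: "x \<in> V" for x
  proof -
    have d: "\<sigma> differentiable at x" "?P differentiable at (\<sigma> x)"
      using Ck_on_2D(1) V P that by blast+
    obtain E where "E ** jacobian ?P (at (\<sigma> x)) = mat 1"
      using eqs(1)[OF V(3)[OF x]] by (auto simp: invertible_left_inverse)
    then have "E *v (jacobian ?P (at (\<sigma> x)) *v v) = v" for v by (simp add: matrix_vector_mul_assoc)
    then have "inj ((*v) (jacobian ?P (at (\<sigma> x))))" by (metis injI)
    moreover have "frechet_derivative F (at x) = (*v) (jacobian ?P (at (\<sigma> x))) \<circ> frechet_derivative \<sigma> (at x)"
      unfolding F_def using frechet_derivative_chain[OF d] by (simp add: fun_eq_iff jacobian_mult[OF d(2)])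
    ultimately show ?thesis using inj[OF that] by (simp add: inj_compose)
  qed
  define e where "e = (\<lambda>k y. matrix_inv (jacobian ?P (at y)) *v axis k 1)"
  define \<beta> where "\<beta> = (\<lambda>y. - (matrix_inv (jacobian ?P (at y)) *v
    (\<Sum>k\<in>UNIV. second_deriv ?P y (e k y) (e k y))))"
  have cE: "continuous_on U (\<lambda>y. matrix_inv (jacobian ?P (at y)))"
    using eqs(1) by (intro continuous_on_matrix_inv continuous_on_jacobian P) auto
  have ce: "continuous_on U (e k)" for k
    unfolding e_def by (intro continuous_on_matrix_vector_mult cE continuous_on_const)
  have c\<beta>: "continuous_on U \<beta>"
    unfolding \<beta>_def
    by (intro continuous_on_minus continuous_on_matrix_vector_mult cE continuous_on_sum
        continuous_on_second_deriv[OF U(1) P] continuous_on_id ce)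
  have ell: "\<exists>k. z \<bullet> e k y \<noteq> 0" if "y \<in> U" "z \<noteq> 0" for y z
  proof (rule ccontr)
    assume "\<not> ?thesis"
    then have "(transpose (matrix_inv (jacobian ?P (at y))) *v z) \<bullet> axis k 1 = 0" for k
      unfolding transpose_mult_inner by (simp add: e_def)
    then have "transpose (matrix_inv (jacobian ?P (at y))) *v z = 0"
      by (simp add: vec_eq_iff inner_axis del: transpose_matrix_vector)
    moreover have "transpose (jacobian ?P (at y)) ** transpose (matrix_inv (jacobian ?P (at y))) = mat 1"
      using matrix_inv_works(2)[OF eqs(1)[OF that(1)]]
      by (metis matrix_transpose_mul transpose_mat)
    ultimately have "z = 0"
      by (metis matrix_vector_mul_assoc matrix_vector_mul_lid matrix_vector_mult_0_right)
    with that show False by simp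
  qed
  have Lw: "(\<Sum>k\<in>UNIV. second_deriv ?w y (e k y) (e k y)) + frechet_derivative ?w (at y) (\<beta> y) = 0"
    if y: "y \<in> U" for y
    using trace_graph_hessian[OF U(1) P w y eqs(1)[OF y]] eqs(2)[OF y] by (simp add: e_def \<beta>_def)
  fix N assume N: "unit_normal inner F p N"
  have dF: "F differentiable at p" using Ck_on_2D(1)[OF F p] .
  have N0: "transpose (jacobian F (at p)) *v N = 0"
    using N normal_iff_jacobian[OF dF] by (simp add: unit_normal_def)
  have "trace (matrix_inv (first_fundamental_form inner F p) ** second_fundamental_form inner F p N) = 0"
  proof (rule mean_curvature_zero_closed[OF V(1) F injF p N0])
    fix W assume W: "open W" "p \<in> W" "W \<subseteq> V"
    obtain Q where Q: "open Q" "\<sigma> p \<in> Q" "Q \<subseteq> U" "{y \<in> Q. ?w y = c} \<subseteq> \<sigma> ` W"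
      using thick[OF W] by blast
    \<comment> \<open>A smooth image of an open subset of a space of smaller dimension has measure zero.\<close>
    have "negligible (\<sigma> ` W)"
      using dim W(3) Ck_on_2D(1)[OF V(2)]
      by (intro negligible_differentiable_image_lowdim)
        (auto simp: differentiable_on_def intro: differentiable_at_imp_differentiable_on differentiable_at_withinI)
    then have "negligible (interior {y \<in> Q. ?w y = c})"
      using Q(4) interior_subset by (metis negligible_subset)
    then have thin: "interior {y \<in> Q. ?w y = c} = {}"
      using open_not_negligible open_interior by blast
    obtain q where q: "q \<in> Q" "?w q = c" "frechet_derivative ?w (at q) \<noteq> (\<lambda>v. 0)"
    proof (rule regular_point_on_level_set[OF Q(1) Ck_on_subset[OF w Q(3)]
          continuous_on_subset[OF ce Q(3)] continuous_on_subset[OF c\<beta> Q(3)] ell Lw Q(2) level[OF p] thin])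
    qed (use Q(3) in blast)+
    then obtain x where x: "x \<in> W" "q = \<sigma> x" using Q(4) by blast
    have xV: "x \<in> V" using x(1) W(3) by blast
    have \<sigma>x: "\<sigma> x \<in> U" using V(3)[OF xV] .
    have "trace (matrix_inv (first_fundamental_form inner F x) ** second_fundamental_form inner F x N) = 0"
      if "transpose (jacobian F (at x)) *v N = 0" for N
      unfolding F_def
      by (rule level_curvature_at_regular_point[OF dim U(1) P w V(1,2,3) level xV eqs(1)[OF \<sigma>x] _ _
            eqs(2)[OF \<sigma>x] eqs(3)[OF \<sigma>x]])
        (use \<sigma>x q(3) x(2) that injF[OF xV] in \<open>auto simp: F_def simp del: transpose_matrix_vector\<close>)
    then show "\<exists>x\<in>W. \<forall>N. transpose (jacobian F (at x)) *v N = 0 \<longrightarrow>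
        trace (matrix_inv (first_fundamental_form inner F x) ** second_fundamental_form inner F x N) = 0"
      using x(1) by blast
  qed
  then show "mean_curvature inner F p N = 0" by (simp add: mean_curvature_def)
qed

section \<open>Level hypersurfaces in charts of the manifold\<close>

lemma curvature_cong:
  fixes f g :: "real^'m \<Rightarrow> 'v::euclidean_space"
  assumes V: "open V" "Ck_on 2 V f" "p \<in> V" "\<And>x. x \<in> V \<Longrightarrow> f x = g x"
  shows "unit_normal b g p N \<longleftrightarrow> unit_normal b f p N"
    and "mean_curvature b g p N = mean_curvature b f p N"
proof -
  have 1: "partial_deriv i g p = partial_deriv i f p" for i
    using frechet_derivative_transform_within_open[OF Ck_on_2D(1)[OF V(2,3)] V(1,3,4)]
    by (simp add: partial_deriv_def)
  have 2: "partial_deriv i (partial_deriv j g) p = partial_deriv i (partial_deriv j f) p" for i j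
    using second_deriv_cong[OF V(1-4)] by (simp add: partial_deriv_def[abs_def])
  show "unit_normal b g p N \<longleftrightarrow> unit_normal b f p N"
    "mean_curvature b g p N = mean_curvature b f p N"
    by (simp_all add: unit_normal_def mean_curvature_def first_fundamental_form_def
        second_fundamental_form_def 1 2)
qed

lemma chart_inj: "is_chart X (U, \<phi>) \<Longrightarrow> inj_on \<phi> U"
  using homeomorphic_imp_injective_map[of "subtopology X U" "top_of_set (\<phi> ` U)" \<phi>]
  by (auto simp: is_chart_def topspace_subtopology openin_subset inf.absorb2)

lemma chart_image_open:
  assumes "is_chart X (U, \<phi>)" "openin X W" "W \<subseteq> U"
  shows "open (\<phi> ` W)"
proof -
  have "openin (subtopology X U) W"
    using assms(2,3) by (auto simp: openin_subtopology)
  then have "openin (top_of_set (\<phi> ` U)) (\<phi> ` W)"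
    using assms(1) homeomorphic_imp_open_map by (fastforce simp: is_chart_def open_map_def)
  then show ?thesis
    using assms(1) openin_open_trans by (auto simp: is_chart_def)
qed

lemma chart_preimage_open:
  assumes "is_chart X (U, \<phi>)" "open W"
  shows "openin X {q \<in> U. \<phi> q \<in> W}"
proof -
  have U: "openin X U" and hom: "homeomorphic_map (subtopology X U) (top_of_set (\<phi> ` U)) \<phi>"
    using assms(1) by (auto simp: is_chart_def)
  have "openin (top_of_set (\<phi> ` U)) (\<phi> ` U \<inter> W)" using assms(2) by (rule openin_open_Int)
  from openin_continuous_map_preimage[OF homeomorphic_imp_continuous_map[OF hom] this]
  have "openin (subtopology X U) {q \<in> topspace X \<inter> U. \<phi> q \<in> \<phi> ` U \<inter> W}"
    by (simp add: topspace_subtopology)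
  moreover have "{q \<in> topspace X \<inter> U. \<phi> q \<in> \<phi> ` U \<inter> W} = {q \<in> U. \<phi> q \<in> W}"
    using openin_subset[OF U] by auto
  ultimately show ?thesis using U openin_trans_full by metis
qed

text \<open>Around a point of \<open>S\<close>, a chart of \<open>S\<close> is composed with a chart of the ambient manifold, which reduces
  the statement to \<open>level_set_mean_curvature\<close>.\<close>

lemma level_hypersurface_chart:
  fixes X :: "'a topology"
    and A :: "('a, real^'n) chart set"
    and \<psi> :: "'a \<Rightarrow> (real^'n) \<times> real"
    and B :: "('a, real^'m) chart set"
  assumes minimal: "minimal_hypersurface X A \<psi>" and maximal: "maximal_hypersurface X A \<psi>"
    and level: "level_hypersurface X A \<psi> c S B"
    and chart: "(V, \<theta>) \<in> B" and p: "p \<in> \<theta> ` V"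
  defines "F \<equiv> (\<lambda>q. fst (\<psi> q)) \<circ> inv_into V \<theta>"
  obtains W where "open W" "p \<in> W" "\<And>k. Ck_on k W F" "inj (frechet_derivative F (at p))"
    "\<And>N. unit_normal inner F p N \<Longrightarrow> mean_curvature inner F p N = 0"
proof -
  have dim: "CARD('n) = CARD('m) + 1"
    and S: "openin (subtopology X {q \<in> topspace X. snd (\<psi> q) = c}) S"
    and manS: "smooth_manifold (subtopology X S) B"
    and immS: "smooth_immersion (subtopology X S) B X A (\<lambda>q. q)"
    using level by (auto simp: level_hypersurface_def embedded_submanifold_def)
  have man: "smooth_manifold X A" and imm: "smooth_immersion X A euclidean {(UNIV, \<lambda>y. y)} \<psi>"
    and sp: "spacelike A \<psi>" and HL: "zero_mean_curvature lorentz A \<psi>" and HR: "zero_mean_curvature inner A \<psi>"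
    using minimal maximal
    by (simp_all add: minimal_hypersurface_def maximal_hypersurface_def hypersurface_def)
  have SZ: "S \<subseteq> {q \<in> topspace X. snd (\<psi> q) = c}"
    using openin_subset[OF S] by auto
  have chV: "is_chart (subtopology X S) (V, \<theta>)"
    using manS chart unfolding smooth_manifold_def by blast
  have VS: "V \<subseteq> S"
    using chV openin_subset by (fastforce simp: is_chart_def)
  define s where "s = inv_into V \<theta> p"
  have s: "s \<in> V" "\<theta> s = p" using p by (auto simp: s_def inv_into_into f_inv_into_f)
  have charts: "\<forall>C\<in>A. is_chart X C" and cover: "(\<Union>(U, \<phi>)\<in>A. U) = topspace X"
    using man unfolding smooth_manifold_def by blast+
  have "s \<in> (\<Union>(U, \<phi>)\<in>A. U)" unfolding cover using s(1) VS SZ by blast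
  then obtain U \<phi> where U\<phi>: "(U, \<phi>) \<in> A" "s \<in> U"
    by blast
  have chU: "is_chart X (U, \<phi>)" using charts U\<phi>(1) by blast
  note injV = chart_inj[OF chV] and injU = chart_inj[OF chU]
  have oU: "openin X U" using chU by (simp add: is_chart_def)
  define G where "G = \<psi> \<circ> inv_into U \<phi>"
  define \<sigma> where "\<sigma> = \<phi> \<circ> (\<lambda>q. q) \<circ> inv_into V \<theta>"
  let ?O = "\<theta> ` {q \<in> V. q \<in> U}" and ?\<Omega> = "\<phi> ` U"
  have "openin (subtopology X S) {q \<in> V. q \<in> U}"
  proof -
    have "openin (subtopology X S) V" "openin (subtopology X S) (U \<inter> S)"
      using chV oU by (simp add: is_chart_def, auto simp: openin_subtopology)
    then have "openin (subtopology X S) (V \<inter> (U \<inter> S))" by (rule openin_Int)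
    moreover have "V \<inter> (U \<inter> S) = {q \<in> V. q \<in> U}" using VS by auto
    ultimately show ?thesis by simp
  qed
  then have O: "open ?O" by (rule chart_image_open[OF chV]) auto
  have \<Omega>: "open ?\<Omega>" using chU by (simp add: is_chart_def)
  have G_smooth: "Ck_on k ?\<Omega> G" for k
  proof -
    have "smooth_on (\<phi> ` {p \<in> U. \<psi> p \<in> UNIV}) ((\<lambda>y. y) \<circ> \<psi> \<circ> inv_into U \<phi>)"
      using imm U\<phi>(1) by (fastforce simp: smooth_immersion_def smooth_map_def)
    then show ?thesis by (simp add: G_def o_def smooth_on_def)
  qed
  have \<sigma>_smooth: "Ck_on k ?O \<sigma>" and \<sigma>_inj: "x \<in> ?O \<Longrightarrow> inj (frechet_derivative \<sigma> (at x))" for k x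
    using immS U\<phi>(1) chart unfolding \<sigma>_def smooth_immersion_def smooth_map_def smooth_on_def
    by fast+
  have pO: "p \<in> ?O" using s U\<phi>(2) by auto
  have \<sigma>_\<theta>: "\<sigma> (\<theta> q) = \<phi> q" if "q \<in> V" for q
    using that injV by (simp add: \<sigma>_def)
  have G_\<phi>: "G (\<phi> q) = \<psi> q" if "q \<in> U" for q
    using that injU by (simp add: G_def)
  have \<sigma>_in: "\<sigma> x \<in> ?\<Omega>" if "x \<in> ?O" for x
    using that \<sigma>_\<theta> by auto
  have FG: "fst (G (\<sigma> x)) = F x" and level_G: "snd (G (\<sigma> x)) = c" if "x \<in> ?O" for x
    using that VS SZ injV by (auto simp: \<sigma>_\<theta> G_\<phi> F_def)
  have thick: "\<exists>Q. open Q \<and> \<sigma> p \<in> Q \<and> Q \<subseteq> ?\<Omega> \<and> {y \<in> Q. snd (G y) = c} \<subseteq> \<sigma> ` W"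
    if W: "open W" "p \<in> W" "W \<subseteq> ?O" for W
  proof -
    \<comment> \<open>\<open>T1\<close> cuts the piece of \<open>S\<close> over \<open>W\<close> out of \<open>S\<close>, and \<open>T2\<close> cuts \<open>S\<close> out of its level set;
      so \<open>T1 \<inter> T2\<close> cuts this piece out of the level set.\<close>
    obtain T1 where T1: "openin X T1" "{q \<in> V. \<theta> q \<in> W} = T1 \<inter> S"
      using chart_preimage_open[OF chV W(1)] by (auto simp: openin_subtopology)
    obtain T2 where T2: "openin X T2" "S = T2 \<inter> {q \<in> topspace X. snd (\<psi> q) = c}"
      using S by (auto simp: openin_subtopology)
    let ?Q = "\<phi> ` (U \<inter> (T1 \<inter> T2))"
    have "open ?Q"
      using oU T1(1) T2(1) by (intro chart_image_open[OF chU] openin_Int) auto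
    moreover have "s \<in> T1 \<inter> S" using T1(2) s W(2) by auto
    then have "\<sigma> p \<in> ?Q" using T2(2) U\<phi>(2) \<sigma>_\<theta>[OF s(1)] s(2) by auto
    moreover have "{y \<in> ?Q. snd (G y) = c} \<subseteq> \<sigma> ` W"
    proof
      fix y assume "y \<in> {y \<in> ?Q. snd (G y) = c}"
      then obtain r where r: "y = \<phi> r" "r \<in> U" "r \<in> T1" "r \<in> T2" "snd (\<psi> r) = c"
        using G_\<phi> by auto
      then have "r \<in> S" using T2(2) openin_subset[OF oU] by auto
      then have "r \<in> V" "\<theta> r \<in> W" using T1(2) r(3) by auto
      then show "y \<in> \<sigma> ` W" using r(1) \<sigma>_\<theta> by force
    qed
    ultimately show ?thesis by (intro exI[of _ ?Q]) auto
  qed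
  have sp': "lorentz (frechet_derivative G (at y) v) (frechet_derivative G (at y) v) > 0"
    if "y \<in> ?\<Omega>" "v \<noteq> 0" for y v
    using sp U\<phi>(1) that unfolding spacelike_def G_def Let_def by fast
  have R: "mean_curvature inner G y N = 0" if "y \<in> ?\<Omega>" "unit_normal inner G y N" for y N
    using HR U\<phi>(1) that unfolding zero_mean_curvature_def G_def by fast
  have L: "mean_curvature lorentz G y N = 0" if "y \<in> ?\<Omega>" "unit_normal lorentz G y N" for y N
    using HL U\<phi>(1) that unfolding zero_mean_curvature_def G_def by fast
  let ?H = "\<lambda>x. fst (G (\<sigma> x))"
  have inj: "inj (frechet_derivative ?H (at p))"
    by (rule level_set_mean_curvature(1)[OF dim \<Omega> G_smooth[of 2] sp' R L O \<sigma>_smooth[of 2] \<sigma>_in \<sigma>_inj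
          level_G thick pO pO])
  have H: "mean_curvature inner ?H p N = 0" if "unit_normal inner ?H p N" for N
    by (rule level_set_mean_curvature(2)[OF dim \<Omega> G_smooth[of 2] sp' R L O \<sigma>_smooth[of 2] \<sigma>_in \<sigma>_inj
          level_G thick pO that])
  have smooth: "Ck_on k ?O (\<lambda>x. fst (G (\<sigma> x)))" for k
    by (intro Ck_on_bounded_linear[OF bounded_linear_fst O] Ck_on_compose[OF O \<sigma>_in \<sigma>_smooth G_smooth])
  show thesis
  proof (rule that[OF O pO])
    show "Ck_on k ?O F" for k
      by (rule Ck_on_cong[OF O FG smooth])
    show "inj (frechet_derivative F (at p))"
      using inj frechet_derivative_transform_within_open[OF Ck_on_2D(1)[OF smooth pO] O pO FG]
      by simp
    show "mean_curvature inner F p N = 0" if "unit_normal inner F p N" for N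
      using H that curvature_cong[OF O smooth pO FG] by simp
  qed
qed

theorem theorem1:
  fixes X :: "'a topology"
    and A :: "('a, real^'n) chart set"
    and \<psi> :: "'a \<Rightarrow> (real^'n) \<times> real"
    and c :: real
    and S :: "'a set"
    and B :: "('a, real^'m) chart set"
  assumes "CARD('n) \<ge> 2"
    and "hypersurface X A \<psi>"
    and "spacelike A \<psi>"
    and "minimal_hypersurface X A \<psi>"
    and "maximal_hypersurface X A \<psi>"
    and "level_hypersurface X A \<psi> c S B"
  shows "minimal_hypersurface (subtopology X S) B (\<lambda>q. fst (\<psi> q))"
proof -
  note chart = level_hypersurface_chart[OF assms(4-6)]
  let ?F = "\<lambda>V \<theta>. (\<lambda>q. fst (\<psi> q)) \<circ> inv_into V \<theta>"
  have dim: "CARD('n) = CARD('m) + 1" and man: "smooth_manifold (subtopology X S) B"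
    using assms(6) by (auto simp: level_hypersurface_def embedded_submanifold_def)
  have "continuous_map X euclidean \<psi>"
    using assms(2) by (simp add: hypersurface_def smooth_immersion_def smooth_map_def)
  then have "continuous_map (subtopology X S) euclidean \<psi>"
    by (rule continuous_map_from_subtopology)
  then have cont: "continuous_map (subtopology X S) euclidean (\<lambda>q. fst (\<psi> q))"
    using continuous_map_compose[of _ euclidean \<psi> euclidean fst]
    by (simp add: o_def continuous_on_fst)
  have smooth: "smooth_on (\<theta> ` V) (?F V \<theta>)" if "(V, \<theta>) \<in> B" for V \<theta>
    unfolding smooth_on_def
  proof (intro allI Ck_on_local)
    fix k x assume "x \<in> \<theta> ` V"
    from chart[OF that this] show "\<exists>W. open W \<and> x \<in> W \<and> Ck_on k W (?F V \<theta>)"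
      by metis
  qed
  have inj: "inj (frechet_derivative (?F V \<theta>) (at x))" if "(V, \<theta>) \<in> B" "x \<in> \<theta> ` V" for V \<theta> x
    using chart[OF that] by metis
  have imm: "smooth_immersion (subtopology X S) B euclidean {(UNIV, \<lambda>y. y)} (\<lambda>q. fst (\<psi> q))"
    using cont smooth inj by (fastforce simp: smooth_immersion_def smooth_map_def o_def)
  have "mean_curvature inner (?F V \<theta>) x N = 0"
    if "(V, \<theta>) \<in> B" "x \<in> \<theta> ` V" "unit_normal inner (?F V \<theta>) x N" for V \<theta> x N
    using chart[OF that(1,2)] that(3) by metis
  then show ?thesis
    using dim man imm
    by (auto simp: minimal_hypersurface_def hypersurface_def zero_mean_curvature_def)
qed

end
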